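(* Let $n\ge 2$ and let $\mathcal{T}$ be an $n\times n$ partial symmetric Toeplitz matrix whose pattern $P\subseteq\{1,\dots,n-1\}$ has, for some positive integers $r,k$, one of the following forms: - $P=\{k,2k,\dots,rk\}$; - $P=\{k,2k,\dots,(r-2)k,rk\}$, where $n=(r+1)k$; - $P=\{k,n-k\}$. If $\mathcal{T}$ admits a positive semidefinite completion, then $\mathcal{T}$ admits a positive semidefinite completion that is Toeplitz and whose rank is maximum among all positive semidefinite completions of $\mathcal{T}$.
   Context: All matrices are real. A symmetric $n\times n$ matrix $T$ is Toeplitz if there are reals $t_0,\dots,t_{n-1}$ with $T_{ij}=t_{|i-j|}$ for all $i,j$. For $P\subseteq\{1,\dots,n-1\}$, an $n\times n$ partial symmetric Toeplitz matrix $\mathcal{T}$ with pattern $P$ is given by real data $\{t_k : k\in P\cup\{0\}\}$: the entries $(i,j)$ with $|i-j|\in P\cup\{0\}$ are specified and equal to $t_{|i-j|}$ (the main diagonal is always specified), and all other entries are unspecified. A completion of $\mathcal{T}$ is a symmetric $n\times n$ matrix, not necessarily Toeplitz, that agrees with $\mathcal{T}$ on all specified entries. In the second form, the multiples $k,2k,\dots,(r-2)k$ are absent when $r\le 2$, so that then $P=\{rk\}$. *)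

theory Defs
  imports Complex_Main "Jordan_Normal_Form.DL_Rank"
begin

text \<open>Matrix indices run from 0 to n - 1; only the difference of indices matters for
  Toeplitz structure.\<close>

definition index_dist :: "nat \<Rightarrow> nat \<Rightarrow> nat" where
  "index_dist i j = nat \<bar>int i - int j\<bar>"

definition symmetric_mat :: "nat \<Rightarrow> real mat \<Rightarrow> bool" where
  "symmetric_mat n A \<longleftrightarrow> A \<in> carrier_mat n n \<and> A\<^sup>T = A"

definition psd_mat :: "nat \<Rightarrow> real mat \<Rightarrow> bool" where
  "psd_mat n A \<longleftrightarrow> symmetric_mat n A \<and> (\<forall>v \<in> carrier_vec n. 0 \<le> v \<bullet> (A *\<^sub>v v))"

definition toeplitz_mat :: "nat \<Rightarrow> real mat \<Rightarrow> bool" where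
  "toeplitz_mat n A \<longleftrightarrow> symmetric_mat n A \<and>
     (\<exists>s :: nat \<Rightarrow> real. \<forall>i < n. \<forall>j < n. A $$ (i, j) = s (index_dist i j))"

text \<open>The partial symmetric Toeplitz matrix with pattern \<open>P\<close> and data \<open>t\<close> is represented by
  the pair \<open>P\<close>, \<open>t\<close>; the values of \<open>t\<close> outside \<open>P \<union> {0}\<close> are never used.\<close>

definition completion :: "nat \<Rightarrow> nat set \<Rightarrow> (nat \<Rightarrow> real) \<Rightarrow> real mat \<Rightarrow> bool" where
  "completion n P t A \<longleftrightarrow> symmetric_mat n A \<and>
     (\<forall>i < n. \<forall>j < n. index_dist i j \<in> P \<union> {0} \<longrightarrow> A $$ (i, j) = t (index_dist i j))"

definition psd_completion :: "nat \<Rightarrow> nat set \<Rightarrow> (nat \<Rightarrow> real) \<Rightarrow> real mat \<Rightarrow> bool" where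
  "psd_completion n P t A \<longleftrightarrow> completion n P t A \<and> psd_mat n A"

text \<open>For \<open>r \<le> 2\<close> the interval \<open>{1..r - 2}\<close> is empty (also for \<open>r = 1\<close>, where the subtraction
  truncates), so the second form is then \<open>P = {r * k}\<close>.\<close>

definition admissible_pattern :: "nat \<Rightarrow> nat set \<Rightarrow> nat \<Rightarrow> nat \<Rightarrow> bool" where
  "admissible_pattern n P r k \<longleftrightarrow>
     P = (\<lambda>j. j * k) ` {1..r} \<or>
     (P = (\<lambda>j. j * k) ` {1..r - 2} \<union> {r * k} \<and> n = (r + 1) * k) \<or>
     P = {k, n - k}"

end

theory Submission
  imports Defs "HOL-Analysis.Elementary_Metric_Spaces"
begin

text \<open>
  All three forms of \<open>P\<close> satisfy: if \<open>p < q\<close> are in \<open>P\<close>, then \<open>q - p \<in> P\<close> or \<open>p + q = n\<close>.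
  Replace the diagonal \<open>t 0\<close> by \<open>t 0 + e\<close>, \<open>e > 0\<close>. The positive definite completion \<open>M\<close> of maximal
  determinant has an inverse \<open>K\<close> vanishing at all unspecified positions, and such a completion is
  unique. Uniqueness makes \<open>M\<close> invariant under the flip \<open>i \<mapsto> n - 1 - i\<close>. Applied to the two principal
  submatrices obtained by deleting the last or the first index, whose inverses are Schur complements
  in \<open>K\<close>, it also shows that these submatrices coincide, so \<open>M\<close> is Toeplitz. For every positive
  semidefinite completion \<open>B\<close> one has \<open>tr (K (B + e I)) = tr (K M) = n\<close>, whence \<open>B \<le> n M\<close> in the
  semidefinite order. A limit of these \<open>M\<close> as \<open>e \<rightarrow> 0\<close> is a Toeplitz completion that dominates all
  others in this sense, so its kernel is the smallest and its rank the largest.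
\<close>

subsection \<open>Positive semidefinite kernels on finite index sets\<close>

text \<open>Kernels are functions on an arbitrary index set: a principal submatrix is the same
  function on a smaller set, and a permutation or shift of indices is a composition.\<close>

definition mat_vec_on :: "'a set \<Rightarrow> ('a \<Rightarrow> 'a \<Rightarrow> real) \<Rightarrow> ('a \<Rightarrow> real) \<Rightarrow> 'a \<Rightarrow> real" where
  "mat_vec_on I A y i = (\<Sum>j\<in>I. A i j * y j)"

definition bilin_on :: "'a set \<Rightarrow> ('a \<Rightarrow> 'a \<Rightarrow> real) \<Rightarrow> ('a \<Rightarrow> real) \<Rightarrow> ('a \<Rightarrow> real) \<Rightarrow> real" where
  "bilin_on I A x y = (\<Sum>i\<in>I. x i * mat_vec_on I A y i)"

definition sym_on :: "'a set \<Rightarrow> ('a \<Rightarrow> 'a \<Rightarrow> real) \<Rightarrow> bool" where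
  "sym_on I A \<longleftrightarrow> (\<forall>i\<in>I. \<forall>j\<in>I. A i j = A j i)"

definition psd_on :: "'a set \<Rightarrow> ('a \<Rightarrow> 'a \<Rightarrow> real) \<Rightarrow> bool" where
  "psd_on I A \<longleftrightarrow> sym_on I A \<and> (\<forall>x. 0 \<le> bilin_on I A x x)"

text \<open>Only \<open>K A = 1\<close> and symmetry of \<open>K\<close> are demanded; for symmetric
  \<open>A\<close>, transposition yields \<open>A K = 1\<close> as well.\<close>

definition inverse_on :: "'a set \<Rightarrow> ('a \<Rightarrow> 'a \<Rightarrow> real) \<Rightarrow> ('a \<Rightarrow> 'a \<Rightarrow> real) \<Rightarrow> bool" where
  "inverse_on I A K \<longleftrightarrow> sym_on I K \<and>
     (\<forall>i\<in>I. \<forall>l\<in>I. (\<Sum>j\<in>I. K i j * A j l) = (if i = l then 1 else 0))"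

lemma sym_onD: "sym_on I A \<Longrightarrow> i \<in> I \<Longrightarrow> j \<in> I \<Longrightarrow> A i j = A j i"
  by (simp add: sym_on_def)

lemma psd_onD: "psd_on I A \<Longrightarrow> 0 \<le> bilin_on I A x x"
  by (simp add: psd_on_def)

lemma psd_on_sym: "psd_on I A \<Longrightarrow> sym_on I A"
  by (simp add: psd_on_def)

lemma sum_rotate3:
  "(\<Sum>m\<in>A. \<Sum>i\<in>B. \<Sum>j\<in>C. f m i j) = (\<Sum>i\<in>B. \<Sum>j\<in>C. \<Sum>m\<in>A. f m i j)"
  by (subst sum.swap) (intro sum.cong refl sum.swap)

lemma bilin_on_expand: "bilin_on I A x y = (\<Sum>i\<in>I. \<Sum>j\<in>I. x i * A i j * y j)"
  unfolding bilin_on_def mat_vec_on_def by (simp add: sum_distrib_left mult.assoc)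

lemma bilin_on_cong:
  assumes "\<And>i. i \<in> I \<Longrightarrow> x i = x' i" "\<And>i. i \<in> I \<Longrightarrow> y i = y' i"
    "\<And>i j. i \<in> I \<Longrightarrow> j \<in> I \<Longrightarrow> A i j = A' i j"
  shows "bilin_on I A x y = bilin_on I A' x' y'"
  unfolding bilin_on_expand using assms by (intro sum.cong) auto

lemma bilin_on_commute:
  assumes "sym_on I A" shows "bilin_on I A x y = bilin_on I A y x"
proof -
  have "bilin_on I A x y = (\<Sum>j\<in>I. \<Sum>i\<in>I. x i * A i j * y j)"
    unfolding bilin_on_expand by (rule sum.swap)
  also have "\<dots> = bilin_on I A y x"
    unfolding bilin_on_expand using assms
    by (intro sum.cong refl) (auto simp: sym_on_def mult_ac)
  finally show ?thesis .
qed

lemma bilin_on_lincomb: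
  assumes "sym_on I A"
  shows "bilin_on I A (\<lambda>i. x i + c * y i) (\<lambda>i. x i + c * y i) =
    bilin_on I A x x + 2 * c * bilin_on I A x y + c\<^sup>2 * bilin_on I A y y"
proof -
  have "bilin_on I A (\<lambda>i. x i + c * y i) (\<lambda>i. x i + c * y i) =
     bilin_on I A x x + c * bilin_on I A x y + c * bilin_on I A y x + c\<^sup>2 * bilin_on I A y y"
    unfolding bilin_on_expand
    by (simp add: sum_distrib_left sum.distrib algebra_simps power2_eq_square)
  then show ?thesis using bilin_on_commute[OF assms, of y x] by simp
qed

lemma discriminant_le:
  fixes a b d :: real
  assumes "\<And>c. 0 \<le> a + 2 * c * b + c\<^sup>2 * d" "0 \<le> d"
  shows "b\<^sup>2 \<le> a * d"
proof (cases "d = 0")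
  case True
  have "b = 0"
  proof (rule ccontr)
    assume "b \<noteq> 0"
    \<comment> \<open>With \<open>d = 0\<close> the polynomial is affine in \<open>c\<close>, and
      this \<open>c\<close> gives it the value -1.\<close>
    then show False
      using assms(1)[of "- (a + 1) / (2 * b)"] True by (simp add: field_simps)
  qed
  then show ?thesis using True by simp
next
  case False
  then have "d > 0" using assms(2) by simp
  \<comment> \<open>The polynomial is evaluated at its minimiser \<open>- b / d\<close>.\<close>
  have "0 \<le> a + 2 * (- b / d) * b + (- b / d)\<^sup>2 * d" by (rule assms(1))
  also have "\<dots> = (a * d - b\<^sup>2) / d" using False by (simp add: field_simps power2_eq_square)
  finally show ?thesis using \<open>d > 0\<close> by (simp add: zero_le_divide_iff)
qed

text \<open>Along the line \<open>x + c y\<close> the form is a nonnegative quadratic in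
  \<open>c\<close>; the claim is its discriminant condition.\<close>

lemma psd_on_Cauchy_Schwarz:
  assumes "psd_on I A"
  shows "(bilin_on I A x y)\<^sup>2 \<le> bilin_on I A x x * bilin_on I A y y"
proof (rule discriminant_le)
  show "0 \<le> bilin_on I A x x + 2 * c * bilin_on I A x y + c\<^sup>2 * bilin_on I A y y" for c
    using bilin_on_lincomb[OF psd_on_sym[OF assms], of x c y] psd_onD[OF assms] by metis
  show "0 \<le> bilin_on I A y y" using assms by (rule psd_onD)
qed

definition unit_fun :: "'a \<Rightarrow> 'a \<Rightarrow> real" where
  "unit_fun a i = (if i = a then 1 else 0)"

lemma mat_vec_on_unit:
  assumes "finite I" "a \<in> I"
  shows "mat_vec_on I A (unit_fun a) i = A i a"
  using assms unfolding mat_vec_on_def unit_fun_def by (simp add: sum.delta if_distrib[of "\<lambda>z. _ * z"] cong: if_cong)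

lemma bilin_on_unit_left:
  assumes "finite I" "a \<in> I"
  shows "bilin_on I A (unit_fun a) y = mat_vec_on I A y a"
  using assms unfolding bilin_on_def unit_fun_def
  by (simp add: sum.delta if_distrib[of "\<lambda>z. z * _"] cong: if_cong)

lemma bilin_on_units:
  assumes "finite I" "a \<in> I" "b \<in> I"
  shows "bilin_on I A (unit_fun a) (unit_fun b) = A a b"
  using assms by (simp add: bilin_on_unit_left mat_vec_on_unit)

lemma psd_on_entry_le:
  assumes "psd_on I A" "finite I" "a \<in> I" "b \<in> I"
  shows "(A a b)\<^sup>2 \<le> A a a * A b b"
  using psd_on_Cauchy_Schwarz[OF assms(1), of "unit_fun a" "unit_fun b"] assms
  by (simp add: bilin_on_units)

lemma psd_on_diag_nonneg:
  assumes "psd_on I A" "finite I" "a \<in> I"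
  shows "0 \<le> A a a"
  using psd_onD[OF assms(1), of "unit_fun a"] assms by (simp add: bilin_on_units)

text \<open>Cauchy-Schwarz against \<open>unit_fun i\<close> bounds the square of coordinate
  \<open>i\<close> of \<open>A x\<close> by a multiple of the form at \<open>x\<close>.\<close>

lemma psd_on_kernel:
  assumes "psd_on I A" "finite I" "bilin_on I A x x = 0" "i \<in> I"
  shows "mat_vec_on I A x i = 0"
proof -
  have "(bilin_on I A (unit_fun i) x)\<^sup>2 \<le> 0"
    using psd_on_Cauchy_Schwarz[OF assms(1), of "unit_fun i" x] assms(3) by simp
  then show ?thesis using assms by (simp add: bilin_on_unit_left)
qed

lemma psd_on_subset:
  assumes "psd_on I A" "J \<subseteq> I" "finite I"
  shows "psd_on J A"
proof -
  have "0 \<le> bilin_on J A x x" for x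
  proof -
    have "bilin_on I A (\<lambda>i. if i \<in> J then x i else 0) (\<lambda>i. if i \<in> J then x i else 0)
        = (\<Sum>i\<in>J. \<Sum>j\<in>I. (if j \<in> J then x i * A i j * x j else 0))"
      unfolding bilin_on_expand using assms(2,3)
      by (intro sum.mono_neutral_cong_right) (auto intro!: sum.cong sum.neutral)
    also have "\<dots> = bilin_on J A x x"
      unfolding bilin_on_expand using assms(2,3)
      by (intro sum.cong refl sum.mono_neutral_cong_right) auto
    finally show ?thesis using psd_onD[OF assms(1)] by metis
  qed
  then show ?thesis using assms by (simp add: psd_on_def sym_on_def subset_iff)
qed

text \<open>Cholesky decomposition by induction on the index set: split off one index and decompose
  its Schur complement.\<close>

lemma psd_on_gram:
  assumes "finite I" "psd_on I A"
  shows "\<exists>w. \<forall>i\<in>I. \<forall>j\<in>I. A i j = (\<Sum>l\<in>I. w l i * w l j)"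
  using assms
proof (induction I arbitrary: A rule: finite_induct)
  case empty
  then show ?case by simp
next
  case (insert a I)
  have fin: "finite (insert a I)" using insert by simp
  have symA: "A i j = A j i" if "i \<in> insert a I" "j \<in> insert a I" for i j
    using sym_onD[OF psd_on_sym[OF insert.prems]] that by blast
  define d where "d = A a a"
  \<comment> \<open>The Schur complement of the pivot \<open>d\<close>. For \<open>d = 0\<close> the
    quotient is 0 by the convention on division, which is the right value because the row of
    \<open>a\<close> then vanishes.\<close>
  define B where "B i j = A i j - A a i * A a j / d" for i j
  have d0: "d \<ge> 0" unfolding d_def using psd_on_diag_nonneg[OF insert.prems fin] by simp
  have zero: "A a j = 0" if "d = 0" "j \<in> insert a I" for j
    using psd_on_entry_le[OF insert.prems fin, of a j] that by (simp add: d_def)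
  have "psd_on I B"
    unfolding psd_on_def
  proof (intro conjI allI)
    show "sym_on I B" using symA by (auto simp: sym_on_def B_def)
    fix x :: "'a \<Rightarrow> real"
    define s where "s = (\<Sum>j\<in>I. A a j * x j)"
    \<comment> \<open>For \<open>d > 0\<close> the value at \<open>a\<close> minimises the form of
      \<open>A\<close> over all extensions of \<open>x\<close>, and the minimum is the form of
      \<open>B\<close> at \<open>x\<close>.\<close>
    define x' where "x' = x(a := - s / d)"
    have x'I: "x' i = x i" if "i \<in> I" for i using that insert.hyps by (auto simp: x'_def)
    have x'a: "x' a = - s / d" by (simp add: x'_def)
    have s': "(\<Sum>j\<in>I. A a j * x' j) = s" unfolding s_def by (intro sum.cong) (auto simp: x'I)
    have s'': "(\<Sum>i\<in>I. x' i * A i a) = s"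
      unfolding s_def by (intro sum.cong) (auto simp: x'I symA)
    have "bilin_on (insert a I) A x' x' =
        x' a * A a a * x' a + x' a * (\<Sum>j\<in>I. A a j * x' j) + ((\<Sum>i\<in>I. x' i * A i a) * x' a
          + bilin_on I A x' x')"
      unfolding bilin_on_expand using insert.hyps
      by (simp add: sum.distrib sum_distrib_left sum_distrib_right mult.assoc)
    also have "bilin_on I A x' x' = bilin_on I A x x"
      by (rule bilin_on_cong) (auto simp: x'I)
    finally have "bilin_on (insert a I) A x' x' = d * (s / d)\<^sup>2 - 2 * s * (s / d) + bilin_on I A x x"
      unfolding s' s'' x'a d_def[symmetric] by (simp add: power2_eq_square algebra_simps)
    also have "\<dots> = bilin_on I A x x - s\<^sup>2 / d"
      by (cases "d = 0") (auto simp: field_simps power2_eq_square)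
    also have "s\<^sup>2 / d = (\<Sum>i\<in>I. \<Sum>j\<in>I. x i * (A a i * A a j / d) * x j)"
      unfolding s_def power2_eq_square sum_product sum_divide_distrib
      by (intro sum.cong refl) (auto simp: mult_ac)
    also have "bilin_on I A x x - \<dots> = bilin_on I B x x"
      unfolding bilin_on_expand B_def by (simp add: algebra_simps sum_subtractf)
    finally show "0 \<le> bilin_on I B x x" using psd_onD[OF insert.prems] by metis
  qed
  then obtain w where w: "\<And>i j. i \<in> I \<Longrightarrow> j \<in> I \<Longrightarrow> B i j = (\<Sum>l\<in>I. w l i * w l j)"
    using insert.IH by blast
  \<comment> \<open>The new vector is the row of \<open>a\<close> scaled by
    \<open>1 / sqrt d\<close>; the old ones are padded by 0 at \<open>a\<close>.\<close>
  define w' where "w' l i = (if l = a then A a i / sqrt d else if i = a then 0 else w l i)" for l i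
  have "A i j = (\<Sum>l\<in>insert a I. w' l i * w' l j)" if ij: "i \<in> insert a I" "j \<in> insert a I" for i j
  proof -
    have "w' a i * w' a j = A a i * A a j / d" using d0 by (simp add: w'_def)
    then have eq: "(\<Sum>l\<in>insert a I. w' l i * w' l j) = A a i * A a j / d + (\<Sum>l\<in>I. w' l i * w' l j)"
      using insert.hyps by simp
    have "(\<Sum>l\<in>I. w' l i * w' l j) = (if i = a \<or> j = a then 0 else (\<Sum>l\<in>I. w l i * w l j))"
      using insert.hyps by (auto simp: w'_def intro!: sum.neutral sum.cong)
    moreover have "A a i * A a j / d = A i j" if "i = a \<or> j = a"
      using that symA[OF ij] zero[OF _ ij(1)] zero[OF _ ij(2)] by (auto simp: d_def)
    ultimately show ?thesis using eq w[of i j] ij by (auto simp: B_def)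
  qed
  then show ?case by blast
qed

lemma inverse_on_right:
  assumes "inverse_on I A K" "sym_on I A" "i \<in> I" "l \<in> I"
  shows "(\<Sum>j\<in>I. A i j * K j l) = (if i = l then 1 else 0)"
proof -
  have "(\<Sum>j\<in>I. A i j * K j l) = (\<Sum>j\<in>I. K l j * A j i)"
    using assms by (intro sum.cong) (auto simp: inverse_on_def sym_on_def)
  also have "\<dots> = (if i = l then 1 else 0)" using assms by (auto simp: inverse_on_def)
  finally show ?thesis .
qed

lemma mat_vec_on_inverse:
  assumes "inverse_on I A K" "finite I" "i \<in> I"
  shows "mat_vec_on I K (mat_vec_on I A x) i = x i"
proof -
  have "mat_vec_on I K (mat_vec_on I A x) i = (\<Sum>l\<in>I. \<Sum>j\<in>I. K i j * A j l * x l)"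
    unfolding mat_vec_on_def by (subst sum.swap) (simp add: sum_distrib_left mult.assoc)
  also have "\<dots> = (\<Sum>l\<in>I. (if i = l then 1 else 0) * x l)"
    using assms by (intro sum.cong refl) (simp add: sum_distrib_right[symmetric] inverse_on_def)
  also have "\<dots> = x i" using assms by (simp add: if_distrib[of "\<lambda>z. z * _"] cong: if_cong)
  finally show ?thesis .
qed

lemma inverse_on_swap:
  assumes "inverse_on I A K" "sym_on I A"
  shows "inverse_on I K A"
  using inverse_on_right[OF assms] assms(2) by (simp add: inverse_on_def)

lemma bilin_on_inverse:
  assumes "inverse_on I A K" "sym_on I A" "finite I"
  shows "bilin_on I A (mat_vec_on I K x) (mat_vec_on I K y) = bilin_on I K x y"
proof -
  have "bilin_on I A (mat_vec_on I K x) (mat_vec_on I K y) = (\<Sum>i\<in>I. mat_vec_on I K x i * y i)"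
    unfolding bilin_on_def using mat_vec_on_inverse[OF inverse_on_swap[OF assms(1,2)] assms(3)]
    by (intro sum.cong) auto
  also have "\<dots> = bilin_on I K y x" unfolding bilin_on_def by (simp add: mult.commute)
  finally show ?thesis using assms(1) by (simp add: inverse_on_def bilin_on_commute)
qed

text \<open>The form of \<open>K\<close> at \<open>x\<close> is the form of \<open>A\<close> at
  \<open>K x\<close>.\<close>

lemma psd_on_inverse:
  assumes "inverse_on I A K" "psd_on I A" "finite I"
  shows "psd_on I K"
  unfolding psd_on_def
proof (intro conjI allI)
  show "sym_on I K" using assms(1) by (simp add: inverse_on_def)
  show "0 \<le> bilin_on I K x x" for x
    using bilin_on_inverse[OF assms(1) psd_on_sym[OF assms(2)] assms(3), of x x] psd_onD[OF assms(2)]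
    by metis
qed

text \<open>Put \<open>E = A - B\<close>, so that \<open>orth\<close> reads tr ((C - D) E) = 0. As
  \<open>D - C = C E D\<close>, this says tr (C E D E) = 0, and a Gram decomposition of
  \<open>D\<close> into vectors \<open>w m\<close> turns this trace into the sum of the values of
  the form of \<open>C\<close> at \<open>E (w m)\<close>. All of them vanish, which forces
  \<open>E (w m) = 0\<close>, then \<open>E D = 0\<close>, and finally
  \<open>E = E D B = 0\<close>.\<close>

lemma inverse_on_unique_dual:
  assumes fin: "finite I"
    and A: "psd_on I A" "inverse_on I A C" and B: "psd_on I B" "inverse_on I B D"
    and orth: "(\<Sum>i\<in>I. \<Sum>j\<in>I. (C i j - D i j) * (A i j - B i j)) = 0"
    and ij: "i \<in> I" "j \<in> I"
  shows "A i j = B i j"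
proof -
  define E where "E i j = A i j - B i j" for i j
  have symE: "E i j = E j i" if "i \<in> I" "j \<in> I" for i j
    using that A(1) B(1) by (simp add: E_def psd_on_def sym_on_def)
  have psdC: "psd_on I C" and psdD: "psd_on I D"
    using psd_on_inverse fin A B by blast+
  obtain w where w: "\<And>i j. i \<in> I \<Longrightarrow> j \<in> I \<Longrightarrow> D i j = (\<Sum>l\<in>I. w l i * w l j)"
    using psd_on_gram[OF fin psdD] by blast
  \<comment> \<open>Expand \<open>C (A - B) D\<close> and use \<open>C A = 1\<close> and
    \<open>B D = 1\<close>.\<close>
  have CED: "(\<Sum>k\<in>I. \<Sum>l\<in>I. C i k * E k l * D l j) = D i j - C i j" if "i \<in> I" "j \<in> I" for i j
  proof -
    have "(\<Sum>k\<in>I. \<Sum>l\<in>I. C i k * E k l * D l j) =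
       (\<Sum>k\<in>I. \<Sum>l\<in>I. C i k * A k l * D l j) - (\<Sum>k\<in>I. \<Sum>l\<in>I. C i k * (B k l * D l j))"
      by (simp add: E_def algebra_simps sum_subtractf)
    also have "(\<Sum>k\<in>I. \<Sum>l\<in>I. C i k * A k l * D l j) = (\<Sum>l\<in>I. (if i = l then 1 else 0) * D l j)"
      using A(2) that
      by (subst sum.swap) (auto simp: sum_distrib_right[symmetric] inverse_on_def intro!: sum.cong)
    also have "\<dots> = D i j" using fin that by (simp add: if_distrib[of "\<lambda>z. z * _"] cong: if_cong)
    also have "(\<Sum>k\<in>I. \<Sum>l\<in>I. C i k * (B k l * D l j)) = (\<Sum>k\<in>I. C i k * (if k = j then 1 else 0))"
      using inverse_on_right[OF B(2) psd_on_sym[OF B(1)]] that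
      by (auto simp: sum_distrib_left[symmetric] intro!: sum.cong)
    also have "\<dots> = C i j" using fin that by (simp add: if_distrib[of "\<lambda>z. _ * z"] cong: if_cong)
    finally show ?thesis .
  qed
  have "(\<Sum>m\<in>I. bilin_on I C (mat_vec_on I E (w m)) (mat_vec_on I E (w m))) = 0"
  proof -
    have "bilin_on I C (mat_vec_on I E (w m)) (mat_vec_on I E (w m)) =
        (\<Sum>i\<in>I. \<Sum>j\<in>I. (\<Sum>k\<in>I. \<Sum>l\<in>I. C i k * E k l * (w m l * w m j)) * E i j)" for m
    proof -
      have "bilin_on I C (mat_vec_on I E (w m)) (mat_vec_on I E (w m)) =
         (\<Sum>i\<in>I. (\<Sum>j\<in>I. E i j * w m j) * (\<Sum>k\<in>I. \<Sum>l\<in>I. C i k * E k l * w m l))"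
        unfolding bilin_on_def mat_vec_on_def by (simp add: sum_distrib_left mult.assoc)
      also have "\<dots> = (\<Sum>i\<in>I. \<Sum>j\<in>I. (\<Sum>k\<in>I. \<Sum>l\<in>I. C i k * E k l * (w m l * w m j)) * E i j)"
        unfolding sum_distrib_right
        by (intro sum.cong refl) (simp add: sum_distrib_left mult_ac)
      finally show ?thesis .
    qed
    then have "(\<Sum>m\<in>I. bilin_on I C (mat_vec_on I E (w m)) (mat_vec_on I E (w m))) =
        (\<Sum>i\<in>I. \<Sum>j\<in>I. \<Sum>m\<in>I. (\<Sum>k\<in>I. \<Sum>l\<in>I. C i k * E k l * (w m l * w m j)) * E i j)"
      by (simp only:) (rule sum_rotate3)
    also have "\<dots> = (\<Sum>i\<in>I. \<Sum>j\<in>I. (\<Sum>k\<in>I. \<Sum>l\<in>I. \<Sum>m\<in>I. C i k * E k l * (w m l * w m j)) * E i j)"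
      unfolding sum_distrib_right[symmetric]
      by (intro sum.cong refl arg_cong2[of _ _ _ _ "(*)"] sum_rotate3)
    also have "\<dots> = (\<Sum>i\<in>I. \<Sum>j\<in>I. (D i j - C i j) * E i j)"
      by (intro sum.cong refl, subst CED[symmetric])
        (auto simp: w sum_distrib_left intro!: sum.cong)
    also have "\<dots> = - (\<Sum>i\<in>I. \<Sum>j\<in>I. (C i j - D i j) * (A i j - B i j))"
      by (simp add: E_def sum_negf[symmetric] algebra_simps)
    finally show ?thesis using orth by simp
  qed
  then have Cw: "bilin_on I C (mat_vec_on I E (w m)) (mat_vec_on I E (w m)) = 0" if "m \<in> I" for m
    using that fin psd_onD[OF psdC] by (simp add: sum_nonneg_eq_0_iff)
  \<comment> \<open>Semidefiniteness of \<open>C\<close> gives \<open>C E (w m) = 0\<close>;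
    multiplying by \<open>A\<close> cancels \<open>C\<close>.\<close>
  have Ew: "mat_vec_on I E (w m) k = 0" if "m \<in> I" "k \<in> I" for m k
  proof -
    have "mat_vec_on I A (mat_vec_on I C (mat_vec_on I E (w m))) k = mat_vec_on I E (w m) k"
      using mat_vec_on_inverse[OF inverse_on_swap[OF A(2) psd_on_sym[OF A(1)]] fin that(2)] .
    moreover have "mat_vec_on I A (mat_vec_on I C (mat_vec_on I E (w m))) k = 0"
      unfolding mat_vec_on_def[of I A] using psd_on_kernel[OF psdC fin Cw[OF that(1)]] by simp
    ultimately show ?thesis by simp
  qed
  have ED: "(\<Sum>l\<in>I. E k l * D l j) = 0" if "k \<in> I" "j \<in> I" for k j
  proof -
    have "(\<Sum>l\<in>I. E k l * D l j) = (\<Sum>l\<in>I. \<Sum>m\<in>I. E k l * w m l * w m j)"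
      using that by (intro sum.cong refl) (simp add: w sum_distrib_left mult_ac)
    also have "\<dots> = (\<Sum>m\<in>I. mat_vec_on I E (w m) k * w m j)"
      unfolding mat_vec_on_def by (subst sum.swap) (simp add: sum_distrib_right)
    also have "\<dots> = 0" using Ew that by simp
    finally show ?thesis .
  qed
  have "0 = (\<Sum>m\<in>I. (\<Sum>l\<in>I. E i l * D l m) * B m j)" using ED ij by simp
  also have "\<dots> = (\<Sum>l\<in>I. E i l * (\<Sum>m\<in>I. D l m * B m j))"
    unfolding sum_distrib_left sum_distrib_right by (subst sum.swap) (simp add: mult.assoc)
  also have "\<dots> = (\<Sum>l\<in>I. E i l * (if l = j then 1 else 0))"
    using B(2) ij by (intro sum.cong) (auto simp: inverse_on_def)
  also have "\<dots> = E i j" using fin ij by (simp add: if_distrib[of "\<lambda>z. _ * z"] cong: if_cong)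
  finally show ?thesis by (simp add: E_def)
qed

text \<open>Decompose \<open>A\<close> into Gram vectors \<open>w l\<close>. The product of
  \<open>w l\<close> and \<open>v\<close> is the \<open>M\<close>-product of \<open>v\<close> and
  \<open>K (w l)\<close>, so Cauchy-Schwarz for \<open>M\<close> bounds its square by the form of
  \<open>K\<close> at \<open>w l\<close> times the form of \<open>M\<close> at \<open>v\<close>. The
  first factors add up to the trace of \<open>K A\<close>.\<close>

lemma psd_on_le_trace_inverse:
  assumes fin: "finite I" and M: "psd_on I M" "inverse_on I M K" and A: "psd_on I A"
  shows "bilin_on I A v v \<le> (\<Sum>i\<in>I. \<Sum>j\<in>I. K i j * A i j) * bilin_on I M v v"
proof -
  obtain w where w: "\<And>i j. i \<in> I \<Longrightarrow> j \<in> I \<Longrightarrow> A i j = (\<Sum>l\<in>I. w l i * w l j)"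
    using psd_on_gram[OF fin A] by blast
  have "bilin_on I A v v = (\<Sum>i\<in>I. \<Sum>j\<in>I. \<Sum>l\<in>I. (w l i * v i) * (w l j * v j))"
    unfolding bilin_on_expand
    by (intro sum.cong refl) (simp add: w sum_distrib_left sum_distrib_right mult_ac)
  also have "\<dots> = (\<Sum>l\<in>I. (\<Sum>i\<in>I. w l i * v i)\<^sup>2)"
    unfolding power2_eq_square sum_product by (rule sum_rotate3[symmetric])
  also have "\<dots> \<le> (\<Sum>l\<in>I. bilin_on I K (w l) (w l) * bilin_on I M v v)"
  proof (rule sum_mono)
    fix l assume "l \<in> I"
    have "bilin_on I M v (mat_vec_on I K (w l)) = (\<Sum>i\<in>I. v i * w l i)"
      unfolding bilin_on_def
      using mat_vec_on_inverse[OF inverse_on_swap[OF M(2) psd_on_sym[OF M(1)]] fin]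
      by (intro sum.cong) auto
    then have "(\<Sum>i\<in>I. w l i * v i) = bilin_on I M v (mat_vec_on I K (w l))"
      by (simp add: mult.commute)
    then show "(\<Sum>i\<in>I. w l i * v i)\<^sup>2 \<le> bilin_on I K (w l) (w l) * bilin_on I M v v"
      using psd_on_Cauchy_Schwarz[OF M(1), of v "mat_vec_on I K (w l)"]
        bilin_on_inverse[OF M(2) psd_on_sym[OF M(1)] fin, of "w l" "w l"]
      by (simp add: mult.commute)
  qed
  also have "\<dots> = (\<Sum>l\<in>I. bilin_on I K (w l) (w l)) * bilin_on I M v v"
    by (simp add: sum_distrib_right)
  also have "(\<Sum>l\<in>I. bilin_on I K (w l) (w l)) = (\<Sum>i\<in>I. \<Sum>j\<in>I. \<Sum>l\<in>I. K i j * (w l i * w l j))"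
    unfolding bilin_on_expand by (subst sum_rotate3) (simp add: mult_ac)
  also have "\<dots> = (\<Sum>i\<in>I. \<Sum>j\<in>I. K i j * A i j)"
    by (intro sum.cong refl) (simp add: w sum_distrib_left)
  finally show ?thesis .
qed

subsection \<open>Determinants and limits\<close>

definition fun_mat :: "nat \<Rightarrow> (nat \<Rightarrow> nat \<Rightarrow> 'a) \<Rightarrow> 'a mat" where
  "fun_mat n A = mat n n (\<lambda>(i, j). A i j)"

text \<open>This adds \<open>s\<close> times a matrix unit. A symmetric perturbation is two such
  changes, and the determinant is affine in each.\<close>

definition entry_add :: "(nat \<Rightarrow> nat \<Rightarrow> 'a::comm_ring_1) \<Rightarrow> nat \<Rightarrow> nat \<Rightarrow> 'a \<Rightarrow> nat \<Rightarrow> nat \<Rightarrow> 'a" where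
  "entry_add A i j s a b = A a b + (if a = i \<and> b = j then s else 0)"

lemma fun_mat_carrier [simp]: "fun_mat n A \<in> carrier_mat n n"
  by (simp add: fun_mat_def)

lemma fun_mat_dim [simp]: "dim_row (fun_mat n A) = n" "dim_col (fun_mat n A) = n"
  by (simp_all add: fun_mat_def)

lemma fun_mat_index [simp]: "i < n \<Longrightarrow> j < n \<Longrightarrow> fun_mat n A $$ (i, j) = A i j"
  by (simp add: fun_mat_def)

lemma fun_mat_mult_vec_index:
  "i < n \<Longrightarrow> v \<in> carrier_vec n \<Longrightarrow>
    (fun_mat n A *\<^sub>v v) $ i = mat_vec_on {..<n} A (\<lambda>j. v $ j) i"
  by (simp add: scalar_prod_def mat_vec_on_def atLeast0LessThan)

lemma cofactor_entry_add_same: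
  assumes "i < n" "j < n" "l < n"
  shows "cofactor (fun_mat n (entry_add A i j s)) i l = cofactor (fun_mat n A) i l"
proof -
  have "mat_delete (fun_mat n (entry_add A i j s)) i l = mat_delete (fun_mat n A) i l"
    using assms by (intro eq_matI) (auto simp: mat_delete_def entry_add_def fun_mat_def)
  then show ?thesis by (simp add: cofactor_def)
qed

text \<open>Laplace expansion along row \<open>i\<close>: its cofactors do not see the altered
  row.\<close>

lemma det_entry_add:
  assumes "i < n" "j < n"
  shows "det (fun_mat n (entry_add A i j s)) = det (fun_mat n A) + s * cofactor (fun_mat n A) i j"
proof -
  have "det (fun_mat n (entry_add A i j s)) =
      (\<Sum>l<n. A i l * cofactor (fun_mat n A) i l + (if l = j then s else 0) * cofactor (fun_mat n A) i l)"
    using assms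
    by (subst laplace_expansion_row[OF fun_mat_carrier assms(1)])
      (auto intro!: sum.cong simp: cofactor_entry_add_same entry_add_def distrib_right)
  also have "\<dots> = (\<Sum>l<n. A i l * cofactor (fun_mat n A) i l) + s * cofactor (fun_mat n A) i j"
    using assms by (simp add: sum.distrib if_distrib[of "\<lambda>z. z * _"] cong: if_cong)
  also have "(\<Sum>l<n. A i l * cofactor (fun_mat n A) i l) = det (fun_mat n A)"
    using assms by (subst laplace_expansion_row[OF fun_mat_carrier assms(1)]) (auto intro!: sum.cong)
  finally show ?thesis .
qed

text \<open>As \<open>i \<noteq> j\<close>, the minor without row \<open>j\<close> and column
  \<open>i\<close> still contains the altered entry, so it is affine in \<open>s\<close> with a
  slope independent of \<open>s\<close>.\<close>

lemma cofactor_entry_add_swap: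
  fixes A :: "nat \<Rightarrow> nat \<Rightarrow> 'a::comm_ring_1"
  assumes "i < n" "j < n" "i \<noteq> j"
  shows "\<exists>c. \<forall>s. cofactor (fun_mat n (entry_add A i j s)) j i = cofactor (fun_mat n A) j i + s * c"
proof -
  define B where "B a b = A (if a < j then a else Suc a) (if b < i then b else Suc b)" for a b
  \<comment> \<open>Positions of row \<open>i\<close> and column \<open>j\<close> once row
    \<open>j\<close> and column \<open>i\<close> are deleted.\<close>
  define i' where "i' = (if i < j then i else i - 1)"
  define j' where "j' = (if j < i then j else j - 1)"
  have ij': "i' < n - 1" "j' < n - 1" using assms by (auto simp: i'_def j'_def)
  have del: "mat_delete (fun_mat n A) j i = fun_mat (n - 1) B"
    by (rule eq_matI) (auto simp: mat_delete_def B_def)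
  have "mat_delete (fun_mat n (entry_add A i j s)) j i = fun_mat (n - 1) (entry_add B i' j' s)" for s
    using assms
    by (intro eq_matI)
      (auto simp: mat_delete_def B_def entry_add_def i'_def j'_def split: if_splits)
  then have "cofactor (fun_mat n (entry_add A i j s)) j i = cofactor (fun_mat n A) j i +
      s * ((- 1) ^ (j + i) * cofactor (fun_mat (n - 1) B) i' j')" for s
    unfolding cofactor_def[of "fun_mat n _"] del using det_entry_add[OF ij', of B s]
    by (simp add: algebra_simps)
  then show ?thesis by blast
qed

lemma cofactor_fun_mat_commute:
  assumes "sym_on {..<n} A" "i < n" "j < n"
  shows "cofactor (fun_mat n A) i j = cofactor (fun_mat n A) j i"
proof -
  have "mat_delete (fun_mat n A) j i = (mat_delete (fun_mat n A) i j)\<^sup>T"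
    using assms by (intro eq_matI) (auto simp: mat_delete_def sym_on_def)
  moreover have "mat_delete (fun_mat n A) i j \<in> carrier_mat (n - 1) (n - 1)"
    by (rule mat_delete_carrier) simp
  ultimately show ?thesis by (simp add: cofactor_def det_transpose add.commute)
qed

text \<open>The second change contributes \<open>s\<close> times a cofactor that is itself affine in
  \<open>s\<close>; symmetry merges the two linear terms. The cofactor is thus half the derivative
  in a symmetric pair of entries.\<close>

lemma det_entry_add_sym:
  assumes "sym_on {..<n} A" "i < n" "j < n" "i \<noteq> j"
  obtains c where "\<And>s. det (fun_mat n (entry_add (entry_add A i j s) j i s)) =
    det (fun_mat n A) + 2 * s * cofactor (fun_mat n A) i j + s\<^sup>2 * c"
proof -
  obtain c where c: "\<And>s. cofactor (fun_mat n (entry_add A i j s)) j i = cofactor (fun_mat n A) j i + s * c"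
    using cofactor_entry_add_swap[OF assms(2-4), of A] by blast
  have "det (fun_mat n (entry_add (entry_add A i j s) j i s)) =
    det (fun_mat n A) + 2 * s * cofactor (fun_mat n A) i j + s\<^sup>2 * c" for s
    using assms cofactor_fun_mat_commute[OF assms(1-3)]
    by (simp add: det_entry_add c algebra_simps power2_eq_square)
  then show ?thesis using that by blast
qed

text \<open>A Gram decomposition makes the determinant a square.\<close>

lemma det_psd_nonneg:
  assumes "psd_on {..<n} A"
  shows "0 \<le> det (fun_mat n A)"
proof -
  obtain w where w: "\<And>i j. i < n \<Longrightarrow> j < n \<Longrightarrow> A i j = (\<Sum>l<n. w l i * w l j)"
    using psd_on_gram[OF _ assms] by auto
  have "fun_mat n A = (fun_mat n w)\<^sup>T * fun_mat n w"
    by (rule eq_matI) (auto simp: scalar_prod_def w atLeast0LessThan)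
  then have "det (fun_mat n A) = det (fun_mat n w) * det (fun_mat n w)"
    by (simp add: det_mult[of _ n] det_transpose[of _ n])
  then show ?thesis by simp
qed

lemma det_pos_definite:
  assumes "psd_on {..<n} A"
    and "\<And>v i. bilin_on {..<n} A v v = 0 \<Longrightarrow> i < n \<Longrightarrow> v i = 0"
  shows "0 < det (fun_mat n A)"
proof -
  have "det (fun_mat n A) \<noteq> 0"
  proof
    assume "det (fun_mat n A) = 0"
    then obtain v where v: "v \<in> carrier_vec n" "v \<noteq> 0\<^sub>v n" "fun_mat n A *\<^sub>v v = 0\<^sub>v n"
      using det_0_iff_vec_prod_zero_field[OF fun_mat_carrier, of n A] by auto
    have "mat_vec_on {..<n} A (\<lambda>j. v $ j) i = 0" if "i < n" for i
      using fun_mat_mult_vec_index[OF that v(1), of A] v(3) that by simp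
    then have "bilin_on {..<n} A (\<lambda>j. v $ j) (\<lambda>j. v $ j) = 0" by (simp add: bilin_on_def)
    then have "v = 0\<^sub>v n" using assms(2) v(1) by (intro eq_vecI) auto
    then show False using v(2) by simp
  qed
  then show ?thesis using det_psd_nonneg[OF assms(1)] by simp
qed

text \<open>The adjugate formula; symmetry of \<open>A\<close> makes the cofactor matrix equal to
  its transpose.\<close>

lemma inverse_on_cofactor:
  fixes A :: "nat \<Rightarrow> nat \<Rightarrow> real"
  assumes "sym_on {..<n} A" "det (fun_mat n A) \<noteq> 0"
  shows "inverse_on {..<n} A (\<lambda>i j. cofactor (fun_mat n A) i j / det (fun_mat n A))"
  unfolding inverse_on_def
proof (intro conjI ballI)
  show "sym_on {..<n} (\<lambda>i j. cofactor (fun_mat n A) i j / det (fun_mat n A))"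
    using cofactor_fun_mat_commute[OF assms(1)] by (simp add: sym_on_def)
  fix i l assume il: "i \<in> {..<n}" "l \<in> {..<n}"
  have "(adj_mat (fun_mat n A) * fun_mat n A) $$ (i, l) = (\<Sum>j<n. cofactor (fun_mat n A) j i * A j l)"
    using il by (simp add: adj_mat_def scalar_prod_def atLeast0LessThan)
  also have "\<dots> = (\<Sum>j<n. cofactor (fun_mat n A) i j * A j l)"
    using il cofactor_fun_mat_commute[OF assms(1)] by (intro sum.cong) auto
  finally have "(\<Sum>j<n. cofactor (fun_mat n A) i j * A j l) = (if i = l then det (fun_mat n A) else 0)"
    using il adj_mat(3)[OF fun_mat_carrier, of n A] by (simp split: if_splits)
  then show "(\<Sum>j<n. cofactor (fun_mat n A) i j / det (fun_mat n A) * A j l) = (if i = l then 1 else 0)"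
    using assms(2) by (simp add: sum_divide_distrib[symmetric] split: if_splits)
qed

section \<open>Determinants and semidefiniteness under entrywise limits\<close>

lemma tendsto_det_fun_mat:
  fixes f :: "nat \<Rightarrow> nat \<Rightarrow> nat \<Rightarrow> real"
  assumes "\<And>i j. i < n \<Longrightarrow> j < n \<Longrightarrow> (\<lambda>m. f m i j) \<longlonglongrightarrow> l i j"
  shows "(\<lambda>m. det (fun_mat n (f m))) \<longlonglongrightarrow> det (fun_mat n l)"
proof -
  \<comment> \<open>The Leibniz formula exhibits the determinant as a polynomial in the
    entries.\<close>
  have eq: "det (fun_mat n g) = (\<Sum>p | p permutes {0..<n}. signof p * (\<Prod>i = 0..<n. g i (p i)))"
    for g :: "nat \<Rightarrow> nat \<Rightarrow> real"
    unfolding det_def'[OF fun_mat_carrier]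
    by (intro sum.cong refl arg_cong2[of _ _ _ _ "(*)"] prod.cong)
      (auto simp: permutes_in_image)
  show ?thesis
    unfolding eq
    by (intro tendsto_sum tendsto_mult tendsto_const tendsto_prod assms)
      (auto simp: permutes_in_image)
qed

text \<open>Bolzano-Weierstrass one index at a time; a further subsequence keeps the limits already
  obtained.\<close>

lemma bounded_family_subseq:
  fixes f :: "nat \<Rightarrow> 'a \<Rightarrow> real"
  assumes "finite I" "\<And>m i. i \<in> I \<Longrightarrow> \<bar>f m i\<bar> \<le> b i"
  shows "\<exists>r l. strict_mono r \<and> (\<forall>i\<in>I. (\<lambda>m. f (r m) i) \<longlonglongrightarrow> l i)"
  using assms
proof (induction I rule: finite_induct)
  case empty
  show ?case using strict_mono_id by auto
next
  case (insert a I)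
  then obtain r l where r: "strict_mono (r :: nat \<Rightarrow> nat)" "\<And>i. i \<in> I \<Longrightarrow> (\<lambda>m. f (r m) i) \<longlonglongrightarrow> l i"
    by (metis insertI2)
  have "Bseq (\<lambda>m. f (r m) a)" using insert.prems by (intro BseqI'[of _ "b a"]) auto
  then obtain q where q: "strict_mono q" "convergent (\<lambda>m. f (r (q m)) a)"
    using Bseq_monoseq_convergent seq_monosub[of "\<lambda>m. f (r m) a"] Bseq_subseq[of "\<lambda>m. f (r m) a"]
    by (fastforce simp: o_def)
  then obtain x where x: "(\<lambda>m. f (r (q m)) a) \<longlonglongrightarrow> x" by (auto simp: convergent_def)
  have "(\<lambda>m. f (r (q m)) i) \<longlonglongrightarrow> l i" if "i \<in> I" for i
    using LIMSEQ_subseq_LIMSEQ[OF r(2)[OF that] q(1)] by (simp add: o_def)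
  then have "\<forall>i\<in>insert a I. (\<lambda>m. f ((r \<circ> q) m) i) \<longlonglongrightarrow> (l(a := x)) i"
    using x insert.hyps by auto
  then show ?case using strict_mono_o[OF r(1) q(1)] by blast
qed

lemma bounded_matrix_subseq:
  fixes f :: "nat \<Rightarrow> nat \<Rightarrow> nat \<Rightarrow> real"
  assumes "\<And>m i j. i < n \<Longrightarrow> j < n \<Longrightarrow> \<bar>f m i j\<bar> \<le> b"
  obtains r l where "strict_mono (r :: nat \<Rightarrow> nat)"
    "\<And>i j. i < n \<Longrightarrow> j < n \<Longrightarrow> (\<lambda>m. f (r m) i j) \<longlonglongrightarrow> l i j"
proof -
  have "\<exists>r l. strict_mono r \<and> (\<forall>p\<in>{..<n} \<times> {..<n}. (\<lambda>m. case_prod (f (r m)) p) \<longlonglongrightarrow> l p)"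
    by (rule bounded_family_subseq[of _ "\<lambda>m. case_prod (f m)" "\<lambda>_. b"]) (use assms in auto)
  then obtain r l where "strict_mono (r :: nat \<Rightarrow> nat)"
    "\<forall>p\<in>{..<n} \<times> {..<n}. (\<lambda>m. case_prod (f (r m)) p) \<longlonglongrightarrow> l p" by blast
  then show ?thesis by (intro that[of r "\<lambda>i j. l (i, j)"]) auto
qed

lemma psd_on_limit:
  fixes f :: "nat \<Rightarrow> nat \<Rightarrow> nat \<Rightarrow> real"
  assumes "\<And>i j. i < n \<Longrightarrow> j < n \<Longrightarrow> (\<lambda>m. f m i j) \<longlonglongrightarrow> l i j" "\<And>m. psd_on {..<n} (f m)"
  shows "psd_on {..<n} l"
  unfolding psd_on_def
proof (intro conjI allI)
  have "l i j = l j i" if "i < n" "j < n" for i j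
  proof (rule LIMSEQ_unique[OF assms(1)[OF that]])
    have "f m i j = f m j i" for m
      using sym_onD[OF psd_on_sym[OF assms(2)]] that by simp
    then show "(\<lambda>m. f m i j) \<longlonglongrightarrow> l j i" using assms(1)[OF that(2,1)] by simp
  qed
  then show "sym_on {..<n} l" by (simp add: sym_on_def)
  fix x :: "nat \<Rightarrow> real"
  have "(\<lambda>m. bilin_on {..<n} (f m) x x) \<longlonglongrightarrow> bilin_on {..<n} l x x"
    unfolding bilin_on_expand by (intro tendsto_intros assms) auto
  then show "0 \<le> bilin_on {..<n} l x x"
    by (rule LIMSEQ_le_const) (use psd_onD[OF assms(2)] in auto)
qed

subsection \<open>Completions with sparse inverse\<close>

text \<open>\<open>v i\<close> is the \<open>M\<close>-product of \<open>v\<close> with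
  \<open>K (unit_fun i)\<close>, whose \<open>M\<close>-product with itself is \<open>K i i\<close>.
  This makes the definiteness of \<open>M\<close> quantitative.\<close>

lemma coordinate_le_inverse:
  assumes "finite I" "psd_on I M" "inverse_on I M K" "i \<in> I"
  shows "(v i)\<^sup>2 \<le> K i i * bilin_on I M v v"
proof -
  let ?k = "mat_vec_on I K (unit_fun i)"
  have "bilin_on I M v ?k = (\<Sum>j\<in>I. v j * unit_fun i j)"
    unfolding bilin_on_def
    using mat_vec_on_inverse[OF inverse_on_swap[OF assms(3) psd_on_sym[OF assms(2)]] assms(1)]
    by (intro sum.cong) auto
  also have "\<dots> = v i"
    using assms by (simp add: unit_fun_def if_distrib[of "\<lambda>z. _ * z"] cong: if_cong)
  finally have "bilin_on I M v ?k = v i" .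
  moreover have "bilin_on I M ?k ?k = K i i"
    using bilin_on_inverse[OF assms(3) psd_on_sym[OF assms(2)] assms(1)] assms
    by (simp add: bilin_on_units)
  ultimately show ?thesis
    using psd_on_Cauchy_Schwarz[OF assms(2), of v ?k] by (simp add: mult.commute)
qed

text \<open>The change adds \<open>2 * s * v i * v j\<close> to the form, which
  \<open>coordinate_le_inverse\<close> bounds by the form of \<open>M\<close> itself. So an
  invertible \<open>M\<close> leaves room to move any off-diagonal pair in both directions.\<close>

lemma psd_on_entry_add:
  assumes M: "psd_on {..<n} M" "inverse_on {..<n} M K" and ij: "i < n" "j < n" "i \<noteq> j"
    and s: "\<bar>s\<bar> * (K i i + K j j) \<le> 1"
  shows "psd_on {..<n} (entry_add (entry_add M i j s) j i s)"
  unfolding psd_on_def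
proof (intro conjI allI)
  show "sym_on {..<n} (entry_add (entry_add M i j s) j i s)"
    unfolding sym_on_def
  proof (intro ballI)
    fix a b assume "a \<in> {..<n}" "b \<in> {..<n}"
    then have eq: "M a b = M b a" by (rule sym_onD[OF psd_on_sym[OF M(1)]])
    show "entry_add (entry_add M i j s) j i s a b = entry_add (entry_add M i j s) j i s b a"
      unfolding entry_add_def eq conj_commute[of "b = _"] by (simp add: add_ac)
  qed
  fix v :: "nat \<Rightarrow> real"
  define q where "q = bilin_on {..<n} M v v"
  have q: "q \<ge> 0" unfolding q_def by (rule psd_onD[OF M(1)])
  have single: "(\<Sum>a<n. \<Sum>b<n. if a = c \<and> b = d then x else 0) = x" if "c < n" "d < n" for c d and x :: real
  proof -
    have "(\<Sum>a<n. \<Sum>b<n. if a = c \<and> b = d then x else 0) = (\<Sum>a<n. if a = c then x else 0)"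
      using that by (intro sum.cong refl) auto
    then show ?thesis using that by simp
  qed
  have "bilin_on {..<n} (entry_add (entry_add M i j s) j i s) v v =
     (\<Sum>a<n. \<Sum>b<n. v a * M a b * v b + (if a = i \<and> b = j then s * v i * v j else 0) +
        (if a = j \<and> b = i then s * v i * v j else 0))"
    unfolding bilin_on_expand using ij
    by (intro sum.cong refl) (auto simp: entry_add_def algebra_simps)
  also have "\<dots> = q + 2 * (s * v i * v j)"
    using ij by (simp add: sum.distrib single q_def bilin_on_expand)
  finally have eq: "bilin_on {..<n} (entry_add (entry_add M i j s) j i s) v v = q + 2 * (s * v i * v j)" .
  have "2 * \<bar>v i * v j\<bar> \<le> (v i)\<^sup>2 + (v j)\<^sup>2"
    using sum_squares_bound[of "\<bar>v i\<bar>" "\<bar>v j\<bar>"] by (simp add: abs_mult)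
  also have "\<dots> \<le> (K i i + K j j) * q"
    using coordinate_le_inverse[OF _ M, of i v] coordinate_le_inverse[OF _ M, of j v] ij
    by (simp add: q_def distrib_right)
  finally have "\<bar>s\<bar> * (2 * \<bar>v i * v j\<bar>) \<le> \<bar>s\<bar> * ((K i i + K j j) * q)"
    by (intro mult_left_mono) auto
  also have "\<dots> \<le> q" using mult_right_mono[OF s q] by (simp add: mult.assoc)
  finally have "\<bar>2 * (s * v i * v j)\<bar> \<le> q" by (simp add: abs_mult mult_ac)
  then show "0 \<le> bilin_on {..<n} (entry_add (entry_add M i j s) j i s) v v"
    unfolding eq by linarith
qed

text \<open>By the 2 by 2 principal minors the diagonal controls all entries, so completions with a
  common diagonal are uniformly bounded.\<close>

lemma psd_on_entry_bound:
  fixes A :: "nat \<Rightarrow> nat \<Rightarrow> real"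
  assumes "psd_on {..<n} A" "i < n" "j < n" "\<And>k. k < n \<Longrightarrow> A k k \<le> b"
  shows "\<bar>A i j\<bar> \<le> b"
proof -
  have nn: "0 \<le> A i i" "0 \<le> A j j" using psd_on_diag_nonneg[OF assms(1) finite_lessThan] assms(2,3) by auto
  have "(A i j)\<^sup>2 \<le> A i i * A j j" using psd_on_entry_le[OF assms(1)] assms(2,3) by simp
  also have "\<dots> \<le> b\<^sup>2"
    unfolding power2_eq_square using nn assms(2-4) by (intro mult_mono) (auto intro: order_trans)
  finally show ?thesis using nn assms(4)[OF assms(2)] by (simp add: abs_le_square_iff[symmetric])
qed

lemma quadratic_increase:
  fixes C c d :: real
  assumes "C \<noteq> 0" "0 < d"
  obtains s where "\<bar>s\<bar> \<le> d" "0 < 2 * s * C + s\<^sup>2 * c"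
proof -
  \<comment> \<open>For \<open>s = u * C\<close> the increment is u C^2 (2 + u c). The first bound
    makes the bracket positive, the second gives \<open>\<bar>s\<bar> \<le> d\<close>.\<close>
  define u where "u = min (1 / (\<bar>c\<bar> + 1)) (d / \<bar>C\<bar>)"
  have u: "0 < u" "u * (\<bar>c\<bar> + 1) \<le> 1" "u * \<bar>C\<bar> \<le> d"
    using assms by (auto simp: u_def min_def field_simps split: if_splits)
  have "\<bar>u * c\<bar> \<le> u * (\<bar>c\<bar> + 1)" using u(1) by (simp add: abs_mult)
  then have "0 < 2 + u * c" using u(2) by linarith
  then have "0 < (u * C\<^sup>2) * (2 + u * c)" using u(1) assms(1) by (intro mult_pos_pos) auto
  also have "\<dots> = 2 * (u * C) * C + (u * C)\<^sup>2 * c" by (simp add: power2_eq_square algebra_simps)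
  finally show ?thesis using u by (intro that[of "u * C"]) (auto simp: abs_mult)
qed

text \<open>The completion of maximal determinant does the job: its cofactors at unspecified positions are
  the derivatives of the determinant in the free entries.\<close>

lemma exists_completion_inverse_zero:
  assumes A0: "psd_on {..<n} A0" "0 < det (fun_mat n A0)"
    and S: "\<And>i. S i i" "\<And>i j. S i j \<Longrightarrow> S j i"
  obtains M K where "psd_on {..<n} M" "inverse_on {..<n} M K"
    "\<And>i j. i < n \<Longrightarrow> j < n \<Longrightarrow> S i j \<Longrightarrow> M i j = A0 i j"
    "\<And>i j. i < n \<Longrightarrow> j < n \<Longrightarrow> \<not> S i j \<Longrightarrow> K i j = 0"
proof -
  define C where "C = {A. psd_on {..<n} A \<and> (\<forall>i<n. \<forall>j<n. S i j \<longrightarrow> A i j = A0 i j)}"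
  define D where "D = (\<lambda>A. det (fun_mat n A)) ` C"
  define b where "b = (\<Sum>i<n. A0 i i)"
  have bound: "\<bar>A i j\<bar> \<le> b" if "A \<in> C" "i < n" "j < n" for A i j
  proof (rule psd_on_entry_bound[of n])
    show "psd_on {..<n} A" "i < n" "j < n" using that by (auto simp: C_def)
    fix k assume "k < n"
    have "A0 k k \<le> b" unfolding b_def
      using psd_on_diag_nonneg[OF A0(1) finite_lessThan] \<open>k < n\<close> by (intro member_le_sum) auto
    then show "A k k \<le> b" using that(1) S(1) \<open>k < n\<close> by (auto simp: C_def)
  qed
  \<comment> \<open>Compactness is proved for the set of determinant values; this needs only
    entrywise limits of completions, and the maximum is then attained.\<close>
  have "seq_compact D"
    unfolding seq_compact_def
  proof (intro allI impI)
    fix d :: "nat \<Rightarrow> real" assume "\<forall>m. d m \<in> D"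
    then have "\<forall>m. \<exists>A. A \<in> C \<and> d m = det (fun_mat n A)" by (auto simp: D_def)
    then obtain f where f: "\<And>m. f m \<in> C" "\<And>m. d m = det (fun_mat n (f m))" by metis
    obtain r l where r: "strict_mono (r :: nat \<Rightarrow> nat)"
      and l: "\<And>i j. i < n \<Longrightarrow> j < n \<Longrightarrow> (\<lambda>m. f (r m) i j) \<longlonglongrightarrow> l i j"
      using bounded_matrix_subseq[of n f b] bound f(1) by blast
    have "psd_on {..<n} l" by (rule psd_on_limit[OF l]) (use f(1) in \<open>auto simp: C_def\<close>)
    moreover have "l i j = A0 i j" if "i < n" "j < n" "S i j" for i j
    proof (rule LIMSEQ_unique[OF l[OF that(1,2)]])
      have "f (r m) i j = A0 i j" for m using f(1)[of "r m"] that by (auto simp: C_def)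
      then show "(\<lambda>m. f (r m) i j) \<longlonglongrightarrow> A0 i j" by simp
    qed
    ultimately have "det (fun_mat n l) \<in> D" by (auto simp: C_def D_def)
    moreover have "(d \<circ> r) \<longlonglongrightarrow> det (fun_mat n l)"
      using tendsto_det_fun_mat[OF l] by (simp add: f(2) o_def)
    ultimately show "\<exists>x\<in>D. \<exists>r. strict_mono r \<and> (d \<circ> r) \<longlonglongrightarrow> x" using r by blast
  qed
  then have "compact D" by (simp add: compact_eq_seq_compact_metric)
  moreover have A0D: "det (fun_mat n A0) \<in> D" using A0(1) by (auto simp: D_def C_def)
  ultimately obtain e where e: "e \<in> D" "\<And>x. x \<in> D \<Longrightarrow> x \<le> e"
    using compact_attains_sup[of D] by blast
  then obtain M where M: "M \<in> C" "\<And>A. A \<in> C \<Longrightarrow> det (fun_mat n A) \<le> det (fun_mat n M)"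
    by (auto simp: D_def)
  have detM: "0 < det (fun_mat n M)" using M(2)[of A0] A0 by (auto simp: C_def)
  have psdM: "psd_on {..<n} M" using M(1) by (simp add: C_def)
  define K where "K = (\<lambda>i j. cofactor (fun_mat n M) i j / det (fun_mat n M))"
  have inv: "inverse_on {..<n} M K"
    unfolding K_def using detM by (intro inverse_on_cofactor psd_on_sym[OF psdM]) auto
  have psdK: "psd_on {..<n} K" using psd_on_inverse[OF inv psdM] by simp
  have "K i j = 0" if ij: "i < n" "j < n" "\<not> S i j" for i j
  proof (rule ccontr)
    \<comment> \<open>With a nonzero cofactor, a small symmetric change of the free pair would raise
      the determinant without leaving \<open>C\<close>.\<close>
    assume "K i j \<noteq> 0"
    then have cof: "cofactor (fun_mat n M) i j \<noteq> 0" by (auto simp: K_def)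
    have "i \<noteq> j" using S(1) ij(3) by blast
    obtain c where c: "\<And>s. det (fun_mat n (entry_add (entry_add M i j s) j i s)) =
        det (fun_mat n M) + 2 * s * cofactor (fun_mat n M) i j + s\<^sup>2 * c"
      using det_entry_add_sym[OF psd_on_sym[OF psdM] ij(1,2) \<open>i \<noteq> j\<close>] by blast
    define k where "k = K i i + K j j"
    have k: "0 \<le> k" unfolding k_def using psd_on_diag_nonneg[OF psdK] ij by simp
    \<comment> \<open>The radius respects the bound of \<open>psd_on_entry_add\<close>; the summand
      1 keeps the denominator positive.\<close>
    obtain s where s: "\<bar>s\<bar> \<le> 1 / (k + 1)" "0 < 2 * s * cofactor (fun_mat n M) i j + s\<^sup>2 * c"
      using quadratic_increase[OF cof, of "1 / (k + 1)" c] k by auto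
    have "\<bar>s\<bar> * k \<le> \<bar>s\<bar> * (k + 1)" by (intro mult_left_mono) auto
    also have "\<dots> \<le> 1" using s(1) k by (simp add: field_simps)
    finally have "psd_on {..<n} (entry_add (entry_add M i j s) j i s)"
      using psd_on_entry_add[OF psdM inv ij(1,2) \<open>i \<noteq> j\<close>] by (simp add: k_def)
    moreover have "entry_add (entry_add M i j s) j i s a b = A0 a b"
      if "a < n" "b < n" "S a b" for a b
    proof -
      have "\<not> (a = i \<and> b = j)" "\<not> (a = j \<and> b = i)" using ij(3) S(2) that(3) by blast+
      then have "entry_add (entry_add M i j s) j i s a b = M a b"
        by (simp only: entry_add_def if_False add_0_right)
      also have "\<dots> = A0 a b" using M(1) that unfolding C_def by blast
      finally show ?thesis .
    qed
    ultimately have "entry_add (entry_add M i j s) j i s \<in> C" unfolding C_def by blast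
    then have "det (fun_mat n (entry_add (entry_add M i j s) j i s)) \<le> det (fun_mat n M)" by (rule M(2))
    then show False unfolding c using s(2) by simp
  qed
  then show ?thesis using that[OF psdM inv] M(1) by (auto simp: C_def)
qed

subsection \<open>Toeplitz structure\<close>

lemma index_dist_self [simp]: "index_dist i i = 0"
  by (simp add: index_dist_def)

lemma index_dist_commute: "index_dist i j = index_dist j i"
  by (simp add: index_dist_def)

lemma index_dist_le: "i \<le> j \<Longrightarrow> index_dist i j = j - i"
  by (simp add: index_dist_def)

lemma index_dist_Suc [simp]: "index_dist (Suc i) (Suc j) = index_dist i j"
  by (simp add: index_dist_def)

lemma index_dist_zero_left [simp]: "index_dist 0 i = i"
  by (simp add: index_dist_def)

lemma index_dist_zero_right [simp]: "index_dist i 0 = i"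
  by (simp add: index_dist_def)

lemma index_dist_diff [simp]: "i \<le> N \<Longrightarrow> j \<le> N \<Longrightarrow> index_dist (N - i) (N - j) = index_dist i j"
  by (simp add: index_dist_def)

lemma sym_on_reindex:
  assumes "sym_on I A" "f ` J \<subseteq> I"
  shows "sym_on J (\<lambda>i j. A (f i) (f j))"
  using assms unfolding sym_on_def by blast

lemma inverse_on_reindex:
  assumes "inverse_on I A K" "bij_betw f J I"
  shows "inverse_on J (\<lambda>i j. A (f i) (f j)) (\<lambda>i j. K (f i) (f j))"
  unfolding inverse_on_def
proof (intro conjI ballI)
  show "sym_on J (\<lambda>i j. K (f i) (f j))"
    by (rule sym_on_reindex[of I]) (use assms in \<open>auto simp: inverse_on_def bij_betw_def\<close>)
  fix i l assume il: "i \<in> J" "l \<in> J"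
  then have "f i \<in> I" "f l \<in> I" using assms(2) by (auto simp: bij_betw_def)
  then have "(\<Sum>j\<in>I. K (f i) j * A j (f l)) = (if f i = f l then 1 else 0)"
    using assms(1) by (auto simp: inverse_on_def)
  moreover have "f i = f l \<longleftrightarrow> i = l"
    using assms(2) il by (auto simp: bij_betw_def inj_on_def)
  ultimately show "(\<Sum>j\<in>J. K (f i) (f j) * A (f j) (f l)) = (if i = l then 1 else 0)"
    using sum.reindex_bij_betw[OF assms(2), of "\<lambda>j. K (f i) j * A j (f l)"] by simp
qed

lemma psd_on_reindex:
  assumes "psd_on I A" "bij_betw f J I"
  shows "psd_on J (\<lambda>i j. A (f i) (f j))"
  unfolding psd_on_def
proof (intro conjI allI)
  show "sym_on J (\<lambda>i j. A (f i) (f j))"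
    by (rule sym_on_reindex[of I]) (use assms in \<open>auto simp: psd_on_def bij_betw_def\<close>)
  fix x :: "'b \<Rightarrow> real"
  define y where "y = x \<circ> inv_into J f"
  have y: "y (f i) = x i" if "i \<in> J" for i
    using that assms(2) by (simp add: y_def bij_betw_def)
  have "bilin_on I A y y = bilin_on J (\<lambda>i j. A (f i) (f j)) (\<lambda>i. y (f i)) (\<lambda>i. y (f i))"
    unfolding bilin_on_expand
    by (subst (1 2) sum.reindex_bij_betw[OF assms(2), symmetric]) simp
  also have "\<dots> = bilin_on J (\<lambda>i j. A (f i) (f j)) x x"
    by (rule bilin_on_cong) (simp_all add: y)
  finally show "0 \<le> bilin_on J (\<lambda>i j. A (f i) (f j)) x x"
    using psd_onD[OF assms(1)] by metis
qed

text \<open>A zero on the diagonal of the semidefinite \<open>K\<close> would annihilate its whole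
  row, contradicting \<open>K A = 1\<close>.\<close>

lemma inverse_on_diag_nonzero:
  assumes "finite I" "psd_on I A" "inverse_on I A K" "a \<in> I"
  shows "K a a \<noteq> 0"
proof
  assume "K a a = 0"
  then have "K a j = 0" if "j \<in> I" for j
    using psd_on_entry_le[OF psd_on_inverse[OF assms(3,2,1)] assms(1,4) that] by simp
  then have "(\<Sum>j\<in>I. K a j * A j a) = 0" by simp
  then show False using assms(3,4) by (auto simp: inverse_on_def)
qed

text \<open>Block inversion: the inverse of a principal submatrix is a Schur complement in the full
  inverse. The subtracted term is the fill-in caused by eliminating \<open>a\<close>.\<close>

lemma inverse_on_remove:
  assumes "finite I" "a \<in> I" "inverse_on I A K" "K a a \<noteq> 0"
  shows "inverse_on (I - {a}) A (\<lambda>i j. K i j - K i a * K a j / K a a)"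
  unfolding inverse_on_def
proof (intro conjI ballI)
  have sym: "K i j = K j i" if "i \<in> I" "j \<in> I" for i j
    using assms(3) that by (simp add: inverse_on_def sym_on_def)
  show "sym_on (I - {a}) (\<lambda>i j. K i j - K i a * K a j / K a a)"
    unfolding sym_on_def
  proof (intro ballI)
    fix i j assume "i \<in> I - {a}" "j \<in> I - {a}"
    then show "K i j - K i a * K a j / K a a = K j i - K j a * K a i / K a a"
      using sym[of i j] sym[of i a] sym[of j a] assms(2) by simp
  qed
  fix i l assume il: "i \<in> I - {a}" "l \<in> I - {a}"
  \<comment> \<open>Row \<open>r\<close> of \<open>K A = 1\<close> with the term of \<open>a\<close>
    moved to the right; subtracting a multiple of row \<open>a\<close> cancels these terms.\<close>
  have row: "(\<Sum>j\<in>I - {a}. K r j * A j l) = (if r = l then 1 else 0) - K r a * A a l" if "r \<in> I" for r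
    using assms(1-3) il that by (simp add: sum_diff1 inverse_on_def)
  have "(\<Sum>j\<in>I - {a}. (K i j - K i a * K a j / K a a) * A j l) =
      (\<Sum>j\<in>I - {a}. K i j * A j l) - K i a / K a a * (\<Sum>j\<in>I - {a}. K a j * A j l)"
    by (simp add: sum_distrib_left sum_subtractf algebra_simps)
  also have "\<dots> = (if i = l then 1 else 0)"
    using il assms(2,4) row[of i] row[of a] by auto
  finally show "(\<Sum>j\<in>I - {a}. (K i j - K i a * K a j / K a a) * A j l) = (if i = l then 1 else 0)" .
qed

text \<open>\<open>sparse\<close> is the stationarity condition of the completion of maximal
  determinant. By \<open>inverse_on_unique_dual\<close> it determines \<open>M\<close> together with
  the other assumptions.\<close>

locale sparse_inverse_completion =
  fixes n :: nat and P :: "nat set" and s :: "nat \<Rightarrow> real" and M K :: "nat \<Rightarrow> nat \<Rightarrow> real"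
  assumes psd: "psd_on {..<n} M"
    and inv: "inverse_on {..<n} M K"
    and agree: "\<And>i j. i < n \<Longrightarrow> j < n \<Longrightarrow> index_dist i j \<in> P \<union> {0} \<Longrightarrow> M i j = s (index_dist i j)"
    and sparse: "\<And>i j. i < n \<Longrightarrow> j < n \<Longrightarrow> index_dist i j \<notin> P \<union> {0} \<Longrightarrow> K i j = 0"
begin

text \<open>Reversal preserves \<open>index_dist\<close>, so the reversed pair meets the same
  conditions. In the duality sum every term has a zero factor: the difference of \<open>M\<close> on
  the pattern, that of \<open>K\<close> off it.\<close>

lemma flip:
  assumes "i < n" "j < n"
  shows "M (n - 1 - i) (n - 1 - j) = M i j"
proof -
  let ?f = "\<lambda>i. n - 1 - i"
  have bij: "bij_betw ?f {..<n} {..<n}"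
    by (rule bij_betw_byWitness[of _ ?f]) auto
  have "M i j = M (?f i) (?f j)"
  proof (rule inverse_on_unique_dual[OF _ psd inv psd_on_reindex[OF psd bij] inverse_on_reindex[OF inv bij]])
    have "(K i j - K (?f i) (?f j)) * (M i j - M (?f i) (?f j)) = 0" if "i < n" "j < n" for i j
    proof (cases "index_dist i j \<in> P \<union> {0}")
      case True
      then have "M i j = M (?f i) (?f j)"
        using agree[of i j] agree[of "?f i" "?f j"] that by simp
      then show ?thesis by simp
    next
      case False
      then have "K i j = K (?f i) (?f j)"
        using sparse[of i j] sparse[of "?f i" "?f j"] that by simp
      then show ?thesis by simp
    qed
    then show "(\<Sum>i<n. \<Sum>j<n. (K i j - K (?f i) (?f j)) * (M i j - M (?f i) (?f j))) = 0"
      by (intro sum.neutral ballI) (simp only: lessThan_iff)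
  qed (use assms in auto)
  then show ?thesis by simp
qed

text \<open>Deleting the last vertex and deleting the first one (followed by a shift) leave matrices with
  equal specified entries. Their inverses are supported on the pattern together with the fill-in
  pairs \<open>i + j = n - 2\<close>, where the entries agree by \<open>flip\<close>.\<close>

lemma shift:
  assumes fill: "\<And>p q. p \<in> P \<Longrightarrow> q \<in> P \<Longrightarrow> p < q \<Longrightarrow> q - p \<in> P \<or> p + q = n"
    and "Suc i < n" "Suc j < n"
  shows "M (Suc i) (Suc j) = M i j"
proof -
  define N where "N = n - 1"
  have n: "n = Suc N" using assms by (simp add: N_def)
  \<comment> \<open>The version of \<open>fill\<close> symmetric in \<open>p\<close> and
    \<open>q\<close>; for \<open>p = q\<close> the distance is 0.\<close>
  have fill': "index_dist p q \<in> P \<union> {0} \<or> p + q = n" if "p \<in> P" "q \<in> P" for p q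
    using fill[OF that] fill[OF that(2,1)] by (cases p q rule: linorder_cases) (auto simp: index_dist_def nat_diff_distrib' add.commute)
  \<comment> \<open>\<open>KL\<close> and \<open>KF\<close> are the inverses of \<open>M\<close>
    without the last and without the first index.\<close>
  define KL where "KL i j = K i j - K i N * K N j / K N N" for i j
  define KF where "KF i j = K i j - K i 0 * K 0 j / K 0 0" for i j
  have "inverse_on ({..<n} - {N}) M KL"
    unfolding KL_def
    by (rule inverse_on_remove[OF _ _ inv inverse_on_diag_nonzero[OF _ psd inv]]) (auto simp: n)
  moreover have "{..<n} - {N} = {..<N}" by (auto simp: n)
  ultimately have L: "inverse_on {..<N} M KL" by simp
  have F: "inverse_on ({..<n} - {0}) M KF"
    unfolding KF_def
    by (rule inverse_on_remove[OF _ _ inv inverse_on_diag_nonzero[OF _ psd inv]]) (auto simp: n)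
  have bij: "bij_betw Suc {..<N} ({..<n} - {0})"
    by (rule bij_betw_byWitness[of _ "\<lambda>i. i - 1"]) (auto simp: n)
  have psdL: "psd_on {..<N} M" and psdF: "psd_on ({..<n} - {0}) M"
    using psd_on_subset[OF psd] by (auto simp: n)
  have "M i j = M (Suc i) (Suc j)"
  proof (rule inverse_on_unique_dual[OF _ psdL L psd_on_reindex[OF psdF bij] inverse_on_reindex[OF F bij]])
    have "(KL i j - KF (Suc i) (Suc j)) * (M i j - M (Suc i) (Suc j)) = 0" if ij: "i < N" "j < N" for i j
    proof -
      \<comment> \<open>In the first two cases the entries of the two submatrices agree; in the
        third both inverses vanish.\<close>
      consider "index_dist i j \<in> P \<union> {0}" | "i + j + 2 = n"
        | "index_dist i j \<notin> P \<union> {0}" "i + j + 2 \<noteq> n" by blast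
      then show ?thesis
      proof cases
        case 1
        then have "M i j = M (Suc i) (Suc j)"
          using agree[of i j] agree[of "Suc i" "Suc j"] ij by (simp add: n)
        then show ?thesis by simp
      next
        case 2
        \<comment> \<open>The flip carries \<open>(Suc i, Suc j)\<close> to
          \<open>(j, i)\<close>.\<close>
        then have "n - 1 - Suc i = j" "n - 1 - Suc j = i" by auto
        then have "M (Suc i) (Suc j) = M j i"
          using flip[of "Suc i" "Suc j"] ij by (simp add: n)
        then show ?thesis using sym_onD[OF psd_on_sym[OF psd], of i j] ij by (simp add: n)
      next
        case 3
        \<comment> \<open>Fill-in requires \<open>N - i\<close> and \<open>N - j\<close> in
          \<open>P\<close>. They differ by the distance of \<open>i\<close> and \<open>j\<close>,
          and they sum to \<open>n\<close> exactly when \<open>i + j + 2 = n\<close>, so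
          \<open>fill'\<close> excludes it. The same reasoning with \<open>Suc i\<close> and
          \<open>Suc j\<close> serves for index 0.\<close>
        have "K i N * K N j = 0"
        proof (rule ccontr)
          assume "K i N * K N j \<noteq> 0"
          then have "N - i \<in> P" "N - j \<in> P"
            using sparse[of i N] sparse[of N j] ij by (auto simp: n index_dist_le index_dist_commute[of N])
          then show False using fill'[of "N - i" "N - j"] 3 ij by (auto simp: n)
        qed
        moreover have "K (Suc i) 0 * K 0 (Suc j) = 0"
        proof (rule ccontr)
          assume "K (Suc i) 0 * K 0 (Suc j) \<noteq> 0"
          then have "Suc i \<in> P" "Suc j \<in> P"
            using sparse[of "Suc i" 0] sparse[of 0 "Suc j"] ij by (auto simp: n)
          then show False using fill'[of "Suc i" "Suc j"] 3 by auto
        qed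
        moreover have "K i j = 0" "K (Suc i) (Suc j) = 0"
          using 3 sparse[of i j] sparse[of "Suc i" "Suc j"] ij by (auto simp: n)
        ultimately show ?thesis by (auto simp: KL_def KF_def)
      qed
    qed
    then show "(\<Sum>i<N. \<Sum>j<N. (KL i j - KF (Suc i) (Suc j)) * (M i j - M (Suc i) (Suc j))) = 0"
      by (intro sum.neutral ballI) (simp only: lessThan_iff)
  qed (use assms in \<open>auto simp: n\<close>)
  then show ?thesis by simp
qed

text \<open>\<open>K\<close> vanishes wherever \<open>B\<close> is free, and elsewhere
  \<open>B\<close> equals \<open>M\<close>, so tr (K B) = tr (K M) = n. This trace is the factor in
  \<open>psd_on_le_trace_inverse\<close>.\<close>

lemma dominates:
  assumes B: "psd_on {..<n} B"
    and eq: "\<And>i j. i < n \<Longrightarrow> j < n \<Longrightarrow> index_dist i j \<in> P \<union> {0} \<Longrightarrow> B i j = s (index_dist i j)"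
  shows "bilin_on {..<n} B v v \<le> real n * bilin_on {..<n} M v v"
proof -
  \<comment> \<open>With \<open>M\<close> transposed, each inner sum is a diagonal entry of
    \<open>K M\<close>.\<close>
  have "(\<Sum>i<n. \<Sum>j<n. K i j * B i j) = (\<Sum>i<n. \<Sum>j<n. K i j * M j i)"
  proof (intro sum.cong refl)
    fix i j assume ij: "i \<in> {..<n}" "j \<in> {..<n}"
    show "K i j * B i j = K i j * M j i"
    proof (cases "index_dist i j \<in> P \<union> {0}")
      case True
      then show ?thesis using eq agree[of j i] ij by (simp add: index_dist_commute[of j])
    next
      case False
      then show ?thesis using sparse ij by simp
    qed
  qed
  also have "\<dots> = real n" using inv by (simp add: inverse_on_def)
  finally show ?thesis using psd_on_le_trace_inverse[OF _ psd inv B] by simp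
qed

end

section \<open>Comparing ranks through kernels\<close>

text \<open>Choose a maximal independent set of columns of \<open>A\<close>. The columns of
  \<open>B\<close> in the same positions are independent too: a relation among them, padded by
  zeros, lies in the kernel of \<open>B\<close>, hence in that of \<open>A\<close>, and would relate
  the chosen columns.\<close>

lemma (in vec_space) rank_le_if_kernel_subset:
  assumes A: "A \<in> carrier_mat n k" and B: "B \<in> carrier_mat n k"
    and ker: "\<And>v. v \<in> carrier_vec k \<Longrightarrow> B *\<^sub>v v = 0\<^sub>v n \<Longrightarrow> A *\<^sub>v v = 0\<^sub>v n"
  shows "rank A \<le> rank B"
proof -
  obtain S where S: "maximal S (\<lambda>T. T \<subseteq> set (cols A) \<and> lin_indpt T)"
    using maximal_exists[of "(\<lambda>T. T \<subseteq> set (cols A) \<and> lin_indpt T)" "card (set (cols A))" "{}"]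
    by (meson List.finite_set card_mono empty_iff empty_subsetI finite_lin_indpt2 rev_finite_subset)
  then have sub: "S \<subseteq> set (cols A)" and indpt: "lin_indpt S" by (auto simp: maximal_def)
  obtain xs where xs: "distinct xs" "set xs = S"
    using finite_distinct_list[of S] finite_subset[OF sub] by auto
  have "\<forall>x\<in>S. \<exists>j<k. x = col A j" using sub A by (fastforce simp: cols_def)
  then obtain f where f: "\<And>x. x \<in> S \<Longrightarrow> f x < k" "\<And>x. x \<in> S \<Longrightarrow> x = col A (f x)" by metis
  define m where "m = length xs"
  have fxs: "f (xs ! l) < k" "xs ! l = col A (f (xs ! l))" if "l < m" for l
    using that f xs(2) by (auto simp: m_def)
  define sel where "sel X = mat n m (\<lambda>(i, l). X $$ (i, f (xs ! l)))" for X :: "'a mat"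
  have sel: "sel X \<in> carrier_mat n m" for X by (simp add: sel_def)
  have cols_sel: "cols (sel X) = map (\<lambda>x. col X (f x)) xs" if "X \<in> carrier_mat n k" for X
    using that fxs(1)
    by (intro nth_equalityI) (auto simp: sel_def m_def intro!: eq_vecI)
  have "map (\<lambda>x. col A (f x)) xs = map id xs" using f(2) xs(2) by (intro map_cong) auto
  then have cols_A: "cols (sel A) = xs" using cols_sel[OF A] by simp
  \<comment> \<open>The padding: coefficients of the selected columns go to their positions among
    all \<open>k\<close> columns.\<close>
  define scatter where "scatter v = vec k (\<lambda>j. \<Sum>l<m. if f (xs ! l) = j then v $ l else 0)" for v :: "'a vec"
  have scatter: "X *\<^sub>v scatter v = sel X *\<^sub>v v" if X: "X \<in> carrier_mat n k" and v: "v \<in> carrier_vec m" for X v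
  proof (rule eq_vecI)
    fix i assume "i < dim_vec (sel X *\<^sub>v v)"
    then have i: "i < n" by (simp add: sel_def)
    have "(X *\<^sub>v scatter v) $ i = (\<Sum>j<k. \<Sum>l<m. if j = f (xs ! l) then X $$ (i, j) * v $ l else 0)"
      using i X by (auto simp: scatter_def scalar_prod_def atLeast0LessThan sum_distrib_left intro!: sum.cong)
    also have "\<dots> = (\<Sum>l<m. X $$ (i, f (xs ! l)) * v $ l)"
      using fxs(1) by (subst sum.swap) (simp add: sum.delta)
    also have "\<dots> = (sel X *\<^sub>v v) $ i"
      using i v by (simp add: sel_def scalar_prod_def atLeast0LessThan)
    finally show "(X *\<^sub>v scatter v) $ i = (sel X *\<^sub>v v) $ i" .
  qed (use X in \<open>simp add: sel_def\<close>)
  have inj: "v = 0\<^sub>v m" if v: "v \<in> carrier_vec m" "sel B *\<^sub>v v = 0\<^sub>v n" for v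
  proof (rule ccontr)
    assume "v \<noteq> 0\<^sub>v m"
    have "scatter v \<in> carrier_vec k" by (simp add: scatter_def)
    then have "sel A *\<^sub>v v = 0\<^sub>v n" using ker scatter[OF A v(1)] scatter[OF B v(1)] v(2) by simp
    then have "lin_dep (set (cols (sel A)))"
      using lin_depI[OF sel v(1) \<open>v \<noteq> 0\<^sub>v m\<close>, of A] cols_A xs(1) by simp
    then show False using indpt cols_A xs(2) by simp
  qed
  \<comment> \<open>Independence concerns the set of columns, so repeated columns would lower the
    count. Two equal columns would put a difference of unit vectors into the kernel of
    \<open>sel B\<close>.\<close>
  have dist: "distinct (cols (sel B))"
  proof (rule ccontr)
    assume "\<not> distinct (cols (sel B))"
    then obtain a b where ab: "a < m" "b < m" "a \<noteq> b" "col (sel B) a = col (sel B) b"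
      using sel[of B] by (auto simp: distinct_conv_nth)
    have unit: "sel B *\<^sub>v unit_vec m c = col (sel B) c" if "c < m" for c
      using that sel[of B] by (intro eq_vecI) auto
    have "sel B *\<^sub>v (unit_vec m a - unit_vec m b) = sel B *\<^sub>v unit_vec m a - sel B *\<^sub>v unit_vec m b"
      by (rule mult_minus_distrib_mat_vec[OF sel]) auto
    also have "\<dots> = 0\<^sub>v n"
      using ab unit sel[of B] by simp
    finally have "unit_vec m a - unit_vec m b = (0\<^sub>v m :: 'a vec)" by (intro inj) auto
    then have "(unit_vec m a - unit_vec m b) $ a = (0\<^sub>v m :: 'a vec) $ a" by (rule arg_cong)
    then show False using ab by simp
  qed
  have "lin_indpt (set (cols (sel B)))"
    using lin_depE[OF sel _ dist] inj by blast
  moreover have "set (cols (sel B)) \<subseteq> set (cols B)"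
    using cols_sel[OF B] f(1) xs(2) B by (auto simp: cols_def)
  ultimately have "card (set (cols (sel B))) \<le> rank B" using rank_ge_card_indpt[OF B] by blast
  moreover have "card (set (cols (sel B))) = card S"
    using dist xs cols_sel[OF B] by (metis distinct_card length_map)
  ultimately show ?thesis using rank_card_indpt[OF A S] by simp
qed

subsection \<open>Limits of perturbed completions\<close>

lemma scalar_prod_mult_mat_vec:
  assumes "A \<in> carrier_mat n n" "v \<in> carrier_vec n"
  shows "v \<bullet> (A *\<^sub>v v) = bilin_on {..<n} (\<lambda>i j. A $$ (i, j)) (\<lambda>i. v $ i) (\<lambda>i. v $ i)"
  using assms
  by (auto simp: scalar_prod_def bilin_on_def mat_vec_on_def atLeast0LessThan intro!: sum.cong)

lemma psd_mat_imp_psd_on: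
  assumes "psd_mat n A"
  shows "psd_on {..<n} (\<lambda>i j. A $$ (i, j))"
  unfolding psd_on_def
proof (intro conjI allI)
  have A: "A \<in> carrier_mat n n" "A\<^sup>T = A" using assms by (auto simp: psd_mat_def symmetric_mat_def)
  have "A $$ (i, j) = A $$ (j, i)" if "i < n" "j < n" for i j
    using index_transpose_mat(1)[of i A j] A that by simp
  then show "sym_on {..<n} (\<lambda>i j. A $$ (i, j))" unfolding sym_on_def by blast
  fix x :: "nat \<Rightarrow> real"
  have "0 \<le> vec n x \<bullet> (A *\<^sub>v vec n x)" using assms by (simp add: psd_mat_def)
  also have "\<dots> = bilin_on {..<n} (\<lambda>i j. A $$ (i, j)) x x"
    unfolding scalar_prod_mult_mat_vec[OF A(1) vec_carrier] by (rule bilin_on_cong) auto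
  finally show "0 \<le> bilin_on {..<n} (\<lambda>i j. A $$ (i, j)) x x" .
qed

lemma psd_on_imp_psd_mat:
  assumes "psd_on {..<n} A"
  shows "psd_mat n (fun_mat n A)"
  unfolding psd_mat_def symmetric_mat_def
proof (intro conjI ballI)
  show "(fun_mat n A)\<^sup>T = fun_mat n A"
    using sym_onD[OF psd_on_sym[OF assms]] by (intro eq_matI) auto
  fix v :: "real vec" assume v: "v \<in> carrier_vec n"
  have "v \<bullet> (fun_mat n A *\<^sub>v v) = bilin_on {..<n} A (\<lambda>i. v $ i) (\<lambda>i. v $ i)"
    unfolding scalar_prod_mult_mat_vec[OF fun_mat_carrier v] by (rule bilin_on_cong) auto
  then show "0 \<le> v \<bullet> (fun_mat n A *\<^sub>v v)" using psd_onD[OF assms] by simp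
qed simp

lemma bilin_on_add_diag:
  assumes "finite I"
  shows "bilin_on I (\<lambda>i j. A i j + (if i = j then e else 0)) v v =
    bilin_on I A v v + e * (\<Sum>i\<in>I. (v i)\<^sup>2)"
proof -
  have "bilin_on I (\<lambda>i j. A i j + (if i = j then e else 0)) v v =
      bilin_on I A v v + (\<Sum>i\<in>I. \<Sum>j\<in>I. if i = j then e * (v i)\<^sup>2 else 0)"
    unfolding bilin_on_expand sum.distrib[symmetric]
    by (intro sum.cong refl) (auto simp: algebra_simps power2_eq_square)
  then show ?thesis using assms by (simp add: sum_distrib_left)
qed

lemma psd_on_add_diag:
  assumes "finite I" "psd_on I A" "0 \<le> e"
  shows "psd_on I (\<lambda>i j. A i j + (if i = j then e else 0))"
  unfolding psd_on_def
proof (intro conjI allI)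
  show "sym_on I (\<lambda>i j. A i j + (if i = j then e else 0))"
    unfolding sym_on_def
  proof (intro ballI)
    fix i j assume "i \<in> I" "j \<in> I"
    then show "A i j + (if i = j then e else 0) = A j i + (if j = i then e else 0)"
      using sym_onD[OF psd_on_sym[OF assms(2)]] by (cases "i = j") auto
  qed
  show "0 \<le> bilin_on I (\<lambda>i j. A i j + (if i = j then e else 0)) x x" for x
    unfolding bilin_on_add_diag[OF assms(1)] using psd_onD[OF assms(2)] assms(3)
    by (simp add: sum_nonneg)
qed

text \<open>The added diagonal contributes \<open>e\<close> times the squared norm, so the form is
  positive definite even where \<open>A\<close> degenerates.\<close>

lemma det_add_diag_pos:
  assumes "psd_on {..<n} A" "0 < e"
  shows "0 < det (fun_mat n (\<lambda>i j. A i j + (if i = j then e else 0)))"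
proof (rule det_pos_definite)
  show "psd_on {..<n} (\<lambda>i j. A i j + (if i = j then e else 0))"
    using psd_on_add_diag[OF _ assms(1)] assms(2) by simp
  fix v :: "nat \<Rightarrow> real" and i
  assume "bilin_on {..<n} (\<lambda>i j. A i j + (if i = j then e else 0)) v v = 0" and i: "i < n"
  then have "bilin_on {..<n} A v v + e * (\<Sum>i<n. (v i)\<^sup>2) = 0"
    by (simp add: bilin_on_add_diag)
  moreover have "0 \<le> bilin_on {..<n} A v v" by (rule psd_onD[OF assms(1)])
  moreover have "0 \<le> e * (\<Sum>i<n. (v i)\<^sup>2)" using assms(2) by (simp add: sum_nonneg)
  ultimately have "e * (\<Sum>i<n. (v i)\<^sup>2) = 0" by linarith
  then have "(\<Sum>i<n. (v i)\<^sup>2) = 0" using assms(2) by simp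
  then show "v i = 0" using i by (simp add: sum_nonneg_eq_0_iff)
qed

text \<open>Raising the diagonal supplies the positive definite completion from which the
  determinant is maximised. \<open>B\<close> ranges over completions of the original data. A single
  existential formula allows witnesses to be chosen along a sequence of values of
  \<open>e\<close>.\<close>

lemma perturbed_completion:
  assumes fill: "\<And>p q. p \<in> P \<Longrightarrow> q \<in> P \<Longrightarrow> p < q \<Longrightarrow> q - p \<in> P \<or> p + q = n"
    and A: "psd_on {..<n} A" "\<And>i j. i < n \<Longrightarrow> j < n \<Longrightarrow> index_dist i j \<in> P \<union> {0} \<Longrightarrow> A i j = t (index_dist i j)"
    and e: "0 < e"
  shows "\<exists>M. psd_on {..<n} M \<and>
    (\<forall>i<n. \<forall>j<n. index_dist i j \<in> P \<union> {0} \<longrightarrow> M i j = t (index_dist i j) + (if i = j then e else 0)) \<and>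
    (\<forall>i j. Suc i < n \<longrightarrow> Suc j < n \<longrightarrow> M (Suc i) (Suc j) = M i j) \<and>
    (\<forall>B v. psd_on {..<n} B \<longrightarrow>
      (\<forall>i<n. \<forall>j<n. index_dist i j \<in> P \<union> {0} \<longrightarrow> B i j = t (index_dist i j)) \<longrightarrow>
      bilin_on {..<n} B v v \<le> real n * bilin_on {..<n} M v v)"
proof -
  define s where "s d = t d + (if d = 0 then e else 0)" for d :: nat
  have dist0: "index_dist i j = 0 \<longleftrightarrow> i = j" for i j by (auto simp: index_dist_def)
  define A' where "A' i j = A i j + (if i = j then e else 0)" for i j
  obtain M K where M: "psd_on {..<n} M" "inverse_on {..<n} M K"
    "\<And>i j. i < n \<Longrightarrow> j < n \<Longrightarrow> index_dist i j \<in> P \<union> {0} \<Longrightarrow> M i j = A' i j"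
    "\<And>i j. i < n \<Longrightarrow> j < n \<Longrightarrow> index_dist i j \<notin> P \<union> {0} \<Longrightarrow> K i j = 0"
  proof (rule exists_completion_inverse_zero[of n A' "\<lambda>i j. index_dist i j \<in> P \<union> {0}"])
    show "psd_on {..<n} A'"
      unfolding A'_def using psd_on_add_diag[OF _ A(1)] e by simp
    show "0 < det (fun_mat n A')" unfolding A'_def by (rule det_add_diag_pos[OF A(1) e])
    show "index_dist j i \<in> P \<union> {0}" if "index_dist i j \<in> P \<union> {0}" for i j
      using that by (simp only: index_dist_commute[of j i])
  qed auto
  interpret sparse_inverse_completion n P s M K
    by standard (use M A(2) in \<open>auto simp: A'_def s_def dist0\<close>)
  have "bilin_on {..<n} B v v \<le> real n * bilin_on {..<n} M v v"
    if B: "psd_on {..<n} B" "\<forall>i<n. \<forall>j<n. index_dist i j \<in> P \<union> {0} \<longrightarrow> B i j = t (index_dist i j)" for B v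
  proof -
    \<comment> \<open>Adding \<open>e\<close> to the diagonal raises the form and turns
      \<open>B\<close> into a completion of the perturbed data \<open>s\<close>.\<close>
    have "bilin_on {..<n} B v v \<le> bilin_on {..<n} (\<lambda>i j. B i j + (if i = j then e else 0)) v v"
      using e by (simp add: bilin_on_add_diag sum_nonneg)
    also have "\<dots> \<le> real n * bilin_on {..<n} M v v"
    proof (rule dominates)
      show "psd_on {..<n} (\<lambda>i j. B i j + (if i = j then e else 0))"
        using psd_on_add_diag[OF _ B(1)] e by simp
      show "B i j + (if i = j then e else 0) = s (index_dist i j)"
        if "i < n" "j < n" "index_dist i j \<in> P \<union> {0}" for i j
        using B(2)[rule_format, OF that] by (simp add: s_def dist0)
    qed
    finally show ?thesis .
  qed
  moreover have "M (Suc i) (Suc j) = M i j" if "Suc i < n" "Suc j < n" for i j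
    using shift[OF fill that] by blast
  ultimately show ?thesis
    using M(1) agree by (intro exI[of _ M]) (simp add: s_def dist0)
qed

text \<open>All four properties pass to an entrywise limit as \<open>e\<close> tends to 0;
  domination does because its factor \<open>n\<close> is independent of \<open>e\<close>.\<close>

lemma toeplitz_completion_dominating:
  assumes fill: "\<And>p q. p \<in> P \<Longrightarrow> q \<in> P \<Longrightarrow> p < q \<Longrightarrow> q - p \<in> P \<or> p + q = n"
    and A: "psd_on {..<n} A" "\<And>i j. i < n \<Longrightarrow> j < n \<Longrightarrow> index_dist i j \<in> P \<union> {0} \<Longrightarrow> A i j = t (index_dist i j)"
  obtains M where "psd_on {..<n} M"
    "\<And>i j. i < n \<Longrightarrow> j < n \<Longrightarrow> index_dist i j \<in> P \<union> {0} \<Longrightarrow> M i j = t (index_dist i j)"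
    "\<And>i j. Suc i < n \<Longrightarrow> Suc j < n \<Longrightarrow> M (Suc i) (Suc j) = M i j"
    "\<And>B v. psd_on {..<n} B \<Longrightarrow>
      (\<And>i j. i < n \<Longrightarrow> j < n \<Longrightarrow> index_dist i j \<in> P \<union> {0} \<Longrightarrow> B i j = t (index_dist i j)) \<Longrightarrow>
      bilin_on {..<n} B v v \<le> real n * bilin_on {..<n} M v v"
proof -
  define e where "e m = 1 / real (Suc m)" for m
  have e: "0 < e m" "e m \<le> 1" for m by (auto simp: e_def)
  have "\<forall>m. \<exists>M. psd_on {..<n} M \<and>
    (\<forall>i<n. \<forall>j<n. index_dist i j \<in> P \<union> {0} \<longrightarrow> M i j = t (index_dist i j) + (if i = j then e m else 0)) \<and>
    (\<forall>i j. Suc i < n \<longrightarrow> Suc j < n \<longrightarrow> M (Suc i) (Suc j) = M i j) \<and>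
    (\<forall>B v. psd_on {..<n} B \<longrightarrow>
      (\<forall>i<n. \<forall>j<n. index_dist i j \<in> P \<union> {0} \<longrightarrow> B i j = t (index_dist i j)) \<longrightarrow>
      bilin_on {..<n} B v v \<le> real n * bilin_on {..<n} M v v)"
    by (intro allI perturbed_completion[OF fill A e(1)])
  then obtain f where f: "\<And>m. psd_on {..<n} (f m)"
    "\<And>m i j. i < n \<Longrightarrow> j < n \<Longrightarrow> index_dist i j \<in> P \<union> {0} \<Longrightarrow>
       f m i j = t (index_dist i j) + (if i = j then e m else 0)"
    "\<And>m i j. Suc i < n \<Longrightarrow> Suc j < n \<Longrightarrow> f m (Suc i) (Suc j) = f m i j"
    "\<And>m B v. psd_on {..<n} B \<Longrightarrow>
      (\<forall>i<n. \<forall>j<n. index_dist i j \<in> P \<union> {0} \<longrightarrow> B i j = t (index_dist i j)) \<Longrightarrow>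
      bilin_on {..<n} B v v \<le> real n * bilin_on {..<n} (f m) v v"
    by metis
  \<comment> \<open>The bound \<open>e m \<le> 1\<close> makes the estimate uniform in
    \<open>m\<close>.\<close>
  have "\<bar>f m i j\<bar> \<le> t 0 + 1" if "i < n" "j < n" for m i j
    by (rule psd_on_entry_bound[OF f(1) that]) (simp add: f(2) e(2))
  then obtain r M where r: "strict_mono (r :: nat \<Rightarrow> nat)"
    and lim: "\<And>i j. i < n \<Longrightarrow> j < n \<Longrightarrow> (\<lambda>m. f (r m) i j) \<longlonglongrightarrow> M i j"
    using bounded_matrix_subseq[of n f "t 0 + 1"] by blast
  show thesis
  proof (rule that)
    show "psd_on {..<n} M" by (rule psd_on_limit[OF lim f(1)])
    show "M i j = t (index_dist i j)" if ij: "i < n" "j < n" "index_dist i j \<in> P \<union> {0}" for i j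
    proof (rule LIMSEQ_unique[OF lim[OF ij(1,2)]])
      have "e \<longlonglongrightarrow> 0" unfolding e_def by (rule LIMSEQ_Suc[OF lim_1_over_n])
      then have "(\<lambda>m. e (r m)) \<longlonglongrightarrow> 0" using LIMSEQ_subseq_LIMSEQ[OF _ r] by (auto simp: o_def)
      then have "(\<lambda>m. t (index_dist i j) + (if i = j then e (r m) else 0)) \<longlonglongrightarrow> t (index_dist i j) + 0"
        by (intro tendsto_add tendsto_const) (cases "i = j"; simp)
      then show "(\<lambda>m. f (r m) i j) \<longlonglongrightarrow> t (index_dist i j)" using f(2)[OF ij] by simp
    qed
    show "M (Suc i) (Suc j) = M i j" if "Suc i < n" "Suc j < n" for i j
    proof (rule LIMSEQ_unique[OF lim[OF that]])
      show "(\<lambda>m. f (r m) (Suc i) (Suc j)) \<longlonglongrightarrow> M i j"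
        unfolding f(3)[OF that] using that by (intro lim) auto
    qed
    fix B :: "nat \<Rightarrow> nat \<Rightarrow> real" and v
    assume B: "psd_on {..<n} B"
      "\<And>i j. i < n \<Longrightarrow> j < n \<Longrightarrow> index_dist i j \<in> P \<union> {0} \<Longrightarrow> B i j = t (index_dist i j)"
    have "(\<lambda>m. real n * bilin_on {..<n} (f (r m)) v v) \<longlonglongrightarrow> real n * bilin_on {..<n} M v v"
      unfolding bilin_on_expand by (intro tendsto_intros lim) auto
    then show "bilin_on {..<n} B v v \<le> real n * bilin_on {..<n} M v v"
      by (rule LIMSEQ_le_const) (use f(4)[OF B(1)] B(2) in blast)
  qed
qed

section \<open>Toeplitz form, admissible patterns and the conclusion\<close>

lemma shift_invariant_imp_toeplitz:
  assumes "psd_on {..<n} M" "\<And>i j. Suc i < n \<Longrightarrow> Suc j < n \<Longrightarrow> M (Suc i) (Suc j) = M i j"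
  shows "toeplitz_mat n (fun_mat n M)"
proof -
  have le: "M i (i + d) = M 0 d" if "i + d < n" for i d
    using that
  proof (induction i)
    case (Suc i)
    then show ?case using assms(2)[of i "i + d"] by simp
  qed simp
  have "fun_mat n M $$ (i, j) = M 0 (index_dist i j)" if "i < n" "j < n" for i j
  proof (cases "i \<le> j")
    case True
    then show ?thesis using le[of i "j - i"] that by (simp add: index_dist_le)
  next
    case False
    then have "M j i = M 0 (index_dist i j)"
      using le[of j "i - j"] that by (simp add: index_dist_le index_dist_commute[of i])
    then show ?thesis using sym_onD[OF psd_on_sym[OF assms(1)], of i j] that by simp
  qed
  then show ?thesis
    using psd_on_imp_psd_mat[OF assms(1)] by (auto simp: toeplitz_mat_def psd_mat_def)
qed

text \<open>Multiples of \<open>k\<close> are closed under positive differences up to the gap in the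
  second form, and the two members of the third form add up to \<open>n\<close>. There
  \<open>k < n\<close> keeps \<open>n - k\<close> from being truncated.\<close>

lemma admissible_pattern_fill:
  assumes "admissible_pattern n P r k" "0 < r" "k < n" "p \<in> P" "q \<in> P" "p < q"
  shows "q - p \<in> P \<or> p + q = n"
proof -
  consider "P = (\<lambda>j. j * k) ` {1..r}"
    | "P = (\<lambda>j. j * k) ` {1..r - 2} \<union> {r * k}" "n = (r + 1) * k" | "P = {k, n - k}"
    using assms(1) unfolding admissible_pattern_def by blast
  then show ?thesis
  proof cases
    case 1
    then obtain a b where ab: "p = a * k" "q = b * k" "a \<in> {1..r}" "b \<in> {1..r}"
      using assms(4,5) by blast
    then have "a < b" using assms(6) by simp
    then have "b - a \<in> {1..r}" using ab by auto
    moreover have "q - p = (b - a) * k" by (simp add: ab diff_mult_distrib)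
    ultimately show ?thesis unfolding 1 by blast
  next
    case 2
    have sub: "x \<in> P \<longleftrightarrow> (\<exists>a. x = a * k \<and> (a \<in> {1..r - 2} \<or> a = r))" for x
      unfolding 2 by blast
    obtain a b where ab: "p = a * k" "q = b * k" "a \<in> {1..r - 2} \<or> a = r" "b \<in> {1..r - 2} \<or> b = r"
      using assms(4,5) unfolding sub by blast
    then have "a < b" using assms(6) by simp
    moreover have diff: "q - p = (b - a) * k" by (simp add: ab diff_mult_distrib)
    \<comment> \<open>Two multipliers differ by the missing value \<open>r - 1\<close> only if they
      are \<open>1\<close> and \<open>r\<close>; then
      \<open>p + q = (r + 1) * k = n\<close>.\<close>
    ultimately have "b - a \<in> {1..r - 2} \<or> (a = 1 \<and> b = r)" using ab(3,4) by auto
    then show ?thesis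
    proof
      assume "b - a \<in> {1..r - 2}"
      then show ?thesis using diff sub by blast
    next
      assume "a = 1 \<and> b = r"
      then show ?thesis using ab 2(2) by simp
    qed
  next
    case 3
    then show ?thesis using assms(3-6) by auto
  qed
qed

theorem corollary3p2:
  fixes n :: nat and P :: "nat set" and t :: "nat \<Rightarrow> real"
  assumes "n \<ge> 2"
    and "P \<subseteq> {1..n - 1}"
    and "\<exists>r k :: nat. r > 0 \<and> k > 0 \<and> admissible_pattern n P r k"
    and "\<exists>A. psd_completion n P t A"
  shows "\<exists>M. psd_completion n P t M \<and> toeplitz_mat n M \<and>
    (\<forall>A. psd_completion n P t A \<longrightarrow> vec_space.rank n A \<le> vec_space.rank n M)"
proof -
  interpret vec_space "TYPE(real)" n .
  obtain r k where rk: "0 < r" "0 < k" "admissible_pattern n P r k" using assms(3) by blast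
  have fill: "q - p \<in> P \<or> p + q = n" if pq: "p \<in> P" "q \<in> P" "p < q" for p q
  proof -
    \<comment> \<open>In every form \<open>r * k\<close> or \<open>k\<close> is a specified
      distance, hence less than \<open>n\<close>; either way \<open>k < n\<close>.\<close>
    consider "r * k \<in> P" | "k \<in> P" using rk unfolding admissible_pattern_def by force
    then have "k < n"
    proof cases
      case 1
      then have "r * k \<in> {1..n - 1}" using assms(2) by blast
      then have "r * k < n" using assms(1) by auto
      with \<open>0 < r\<close> show ?thesis by (metis le_less_trans mult_le_mono1 nat_mult_1 One_nat_def Suc_leI)
    next
      case 2
      then have "k \<in> {1..n - 1}" using assms(2) by blast
      then show ?thesis using assms(1) by auto
    qed
    then show ?thesis using admissible_pattern_fill[OF rk(3,1) _ pq] by blast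
  qed
  have psd: "psd_on {..<n} (\<lambda>i j. A $$ (i, j))"
    and entries: "\<And>i j. i < n \<Longrightarrow> j < n \<Longrightarrow> index_dist i j \<in> P \<union> {0} \<Longrightarrow> A $$ (i, j) = t (index_dist i j)"
    if "psd_completion n P t A" for A
    using that psd_mat_imp_psd_on by (auto simp: psd_completion_def completion_def)
  obtain A0 where A0: "psd_completion n P t A0" using assms(4) by blast
  obtain M where M: "psd_on {..<n} M"
    "\<And>i j. i < n \<Longrightarrow> j < n \<Longrightarrow> index_dist i j \<in> P \<union> {0} \<Longrightarrow> M i j = t (index_dist i j)"
    "\<And>i j. Suc i < n \<Longrightarrow> Suc j < n \<Longrightarrow> M (Suc i) (Suc j) = M i j"
    "\<And>B v. psd_on {..<n} B \<Longrightarrow>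
      (\<And>i j. i < n \<Longrightarrow> j < n \<Longrightarrow> index_dist i j \<in> P \<union> {0} \<Longrightarrow> B i j = t (index_dist i j)) \<Longrightarrow>
      bilin_on {..<n} B v v \<le> real n * bilin_on {..<n} M v v"
    using toeplitz_completion_dominating[OF fill psd[OF A0] entries[OF A0]] by blast
  have "psd_completion n P t (fun_mat n M)"
    using psd_on_imp_psd_mat[OF M(1)] M(2)
    by (auto simp: psd_completion_def completion_def psd_mat_def)
  moreover have "toeplitz_mat n (fun_mat n M)" by (rule shift_invariant_imp_toeplitz[OF M(1,3)])
  \<comment> \<open>If \<open>M v = 0\<close>, domination squeezes the form of \<open>A\<close> at
    \<open>v\<close> to 0, and semidefiniteness yields \<open>A v = 0\<close>.\<close>
  moreover have "rank A \<le> rank (fun_mat n M)" if A: "psd_completion n P t A" for A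
  proof (rule rank_le_if_kernel_subset)
    show A_carrier: "A \<in> carrier_mat n n"
      using A by (simp add: psd_completion_def psd_mat_def symmetric_mat_def)
    fix v :: "real vec" assume v: "v \<in> carrier_vec n" "fun_mat n M *\<^sub>v v = 0\<^sub>v n"
    let ?v = "\<lambda>i. v $ i"
    have "mat_vec_on {..<n} M ?v i = 0" if "i < n" for i
      using fun_mat_mult_vec_index[OF that v(1), of M] v(2) that by simp
    then have "bilin_on {..<n} M ?v ?v = 0" by (simp add: bilin_on_def)
    then have "bilin_on {..<n} (\<lambda>i j. A $$ (i, j)) ?v ?v = 0"
      using M(4)[OF psd[OF A] entries[OF A], of ?v] psd_onD[OF psd[OF A], of ?v] by simp
    then have "mat_vec_on {..<n} (\<lambda>i j. A $$ (i, j)) ?v i = 0" if "i < n" for i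
      using psd_on_kernel[OF psd[OF A]] that by simp
    moreover have "(A *\<^sub>v v) $ i = mat_vec_on {..<n} (\<lambda>i j. A $$ (i, j)) ?v i" if "i < n" for i
      using A_carrier v(1) that by (simp add: scalar_prod_def mat_vec_on_def atLeast0LessThan)
    ultimately show "A *\<^sub>v v = 0\<^sub>v n" using A_carrier by (intro eq_vecI) auto
  qed simp
  ultimately show ?thesis by blast
qed

end
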